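(* Let $G$ be a finite directed graph with vertex set $\mathcal V$ and adjacency matrix $A_G$, and let $\rho$ be the inverse of the Perron eigenvalue of $A_G$. Assume $\rho<\frac14$. Then $$h(D_G)>-\log\rho+\max_{\{v\in\mathcal V:\,q_v(\rho^2)>\frac34\}}\frac{p_v(\rho)\Big[q_v(\rho^2)-\frac34-\frac12\sqrt{q_v(\rho^2)-\frac34}\Big]}{\rho\,p'(\rho)\Big[\rho+\sqrt{q_v(\rho^2)-\frac34}\Big]}.$$
   Context: Let $G$ be a finite directed graph with vertex set $\mathcal V$ and edge set $\mathcal E$; $s(e)$ and $r(e)$ are the initial and final vertex of $e\in\mathcal E$; $A_G(u,w)$ is the number of edges from $u$ to $w$. Take two copies $\mathcal E^-=\{e^-:e\in\mathcal E\}$ and $\mathcal E^+=\{e^+:e\in\mathcal E\}$, where $e^-$ goes from $s(e)$ to $r(e)$ and $e^+$ goes from $r(e)$ to $s(e)$. The graph inverse semigroup of $G$ is the semigroup with zero generated by $\mathcal E^-\cup\{P_u:u\in\mathcal V\}\cup\mathcal E^+$ with relations $P_u^2=P_u$, $P_uP_w=0$ for $u\neq w$; $P_{s(e)}e^-=e^-=e^-P_{r(e)}$ and $P_{r(e)}e^+=e^+=e^+P_{s(e)}$; $f^-f^+=P_{s(f)}$ and $f^-g^+=0$ for $f\ne g$; consequently $g^+f^-=0$ if $s(f)\neq s(g)$, $f^-g^-=0$ if $r(f)\ne s(g)$, and $f^+g^+=0$ if $s(f)\neq r(g)$. The Markov-Dyck shift $D_G$ is the subshift over the alphabet $\mathcal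 E^-\cup\mathcal E^+$ whose admissible words are exactly the words whose product in this semigroup is nonzero. The topological entropy of a subshift $X$ is $h(X)=\lim_{n\to\infty}\frac1n\log\#\mathcal L_n(X)$, where $\mathcal L_n(X)$ is the set of admissible words of $X$ of length $n$. $p(z)=\det(I-A_Gz)$; $p_v(z)$ is the determinant of the matrix $I-A_Gz$ with the $v$-th row and $v$-th column deleted; $q_v=p/p_v$; $p'$ is the derivative of $p$. *)

theory Defs
  imports
    "HOL-Analysis.Derivative"
    "Jordan_Normal_Form.Spectral_Radius"
    "Graph_Theory.Digraph"
begin

section \<open>Subshifts and topological entropy\<close>

definition language :: "(int \<Rightarrow> 'a) set \<Rightarrow> nat \<Rightarrow> 'a list set" where
  "language X n = {map (\<lambda>k. x (i + int k)) [0..<n] | x i. x \<in> X}"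

definition topological_entropy :: "(int \<Rightarrow> 'a) set \<Rightarrow> real" where
  "topological_entropy X = lim (\<lambda>n. ln (real (card (language X n))) / real n)"


section \<open>The graph inverse semigroup and the Markov-Dyck shift\<close>

text \<open>
  A finite directed graph (multiple edges and loops allowed) is a \<open>fin_digraph\<close>;
  the edge \<open>e\<close> goes from \<open>tail G e\<close> (written $s(e)$ in the mathematics) to
  \<open>head G e\<close> (written $r(e)$). \<open>Minus e\<close> and \<open>Plus e\<close> stand for $e^-$ and $e^+$.
\<close>

datatype 'e signed_edge = Minus 'e | Plus 'e

definition signed_edges :: "('v, 'e) pre_digraph \<Rightarrow> 'e signed_edge set" where
  "signed_edges G = Minus ` arcs G \<union> Plus ` arcs G"

datatype ('v, 'e) generator = Zero | Proj 'v | Edge "'e signed_edge"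

definition generators :: "('v, 'e) pre_digraph \<Rightarrow> ('v, 'e) generator set" where
  "generators G = {Zero} \<union> Proj ` verts G \<union> Edge ` signed_edges G"

text \<open>
  The graph inverse semigroup is the semigroup with zero presented by the relations below:
  its elements are the classes of nonempty words over the generators under the
  congruence \<open>gis_eq G\<close>, multiplication being concatenation. No relation involves the
  empty word, so its class is a singleton outside of the semigroup.
\<close>

inductive gis_eq :: "('v, 'e) pre_digraph \<Rightarrow>
    ('v, 'e) generator list \<Rightarrow> ('v, 'e) generator list \<Rightarrow> bool" for G where
  refl: "set w \<subseteq> generators G \<Longrightarrow> gis_eq G w w"
| sym: "gis_eq G w w' \<Longrightarrow> gis_eq G w' w"
| trans: "gis_eq G w w' \<Longrightarrow> gis_eq G w' w'' \<Longrightarrow> gis_eq G w w''"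
| congr: "gis_eq G w w' \<Longrightarrow> set a \<subseteq> generators G \<Longrightarrow> set b \<subseteq> generators G \<Longrightarrow>
    gis_eq G (a @ w @ b) (a @ w' @ b)"
| zero_left: "x \<in> generators G \<Longrightarrow> gis_eq G [Zero, x] [Zero]"
| zero_right: "x \<in> generators G \<Longrightarrow> gis_eq G [x, Zero] [Zero]"
| proj_idem: "u \<in> verts G \<Longrightarrow> gis_eq G [Proj u, Proj u] [Proj u]"
| proj_orth: "u \<in> verts G \<Longrightarrow> w \<in> verts G \<Longrightarrow> u \<noteq> w \<Longrightarrow> gis_eq G [Proj u, Proj w] [Zero]"
| minus_left: "e \<in> arcs G \<Longrightarrow> gis_eq G [Proj (tail G e), Edge (Minus e)] [Edge (Minus e)]"
| minus_right: "e \<in> arcs G \<Longrightarrow> gis_eq G [Edge (Minus e), Proj (head G e)] [Edge (Minus e)]"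
| plus_left: "e \<in> arcs G \<Longrightarrow> gis_eq G [Proj (head G e), Edge (Plus e)] [Edge (Plus e)]"
| plus_right: "e \<in> arcs G \<Longrightarrow> gis_eq G [Edge (Plus e), Proj (tail G e)] [Edge (Plus e)]"
| minus_plus: "f \<in> arcs G \<Longrightarrow> gis_eq G [Edge (Minus f), Edge (Plus f)] [Proj (tail G f)]"
| minus_plus_neq: "f \<in> arcs G \<Longrightarrow> g \<in> arcs G \<Longrightarrow> f \<noteq> g \<Longrightarrow>
    gis_eq G [Edge (Minus f), Edge (Plus g)] [Zero]"

definition nonzero_product :: "('v, 'e) pre_digraph \<Rightarrow> 'e signed_edge list \<Rightarrow> bool" where
  "nonzero_product G w \<longleftrightarrow> \<not> gis_eq G (map Edge w) [Zero]"

text \<open>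
  The words over \<open>signed_edges G\<close> with nonzero product are exactly the words occurring in
  points of this subshift: they are closed under taking factors, and a nonempty one
  ending in $e^-$ (in $e^+$) can be prolonged to the right by $e^+$ or by $e^-$, staying
  nonzero, because $e^-e^+e^- = e^-$ and $e^+e^-e^+ = e^+$; similarly on the left.
\<close>

definition markov_dyck_shift :: "('v, 'e) pre_digraph \<Rightarrow> (int \<Rightarrow> 'e signed_edge) set" where
  "markov_dyck_shift G = {x. range x \<subseteq> signed_edges G \<and>
     (\<forall>i n. nonzero_product G (map (\<lambda>k. x (i + int k)) [0..<n]))}"


section \<open>Adjacency matrix, determinants and Perron eigenvalue\<close>

text \<open>
  Rows and columns of a matrix are numbered by an arbitrary enumeration of the vertices.
  The eigenvalues and determinants below do not depend on its choice, since another
  enumeration permutes rows and columns simultaneously.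
\<close>

definition vertex_list :: "('v, 'e) pre_digraph \<Rightarrow> 'v list" where
  "vertex_list G = (SOME vs. distinct vs \<and> set vs = verts G)"

definition vertex_index :: "('v, 'e) pre_digraph \<Rightarrow> 'v \<Rightarrow> nat" where
  "vertex_index G v = (THE i. i < length (vertex_list G) \<and> vertex_list G ! i = v)"

definition num_edges :: "('v, 'e) pre_digraph \<Rightarrow> 'v \<Rightarrow> 'v \<Rightarrow> nat" where
  "num_edges G u w = card {e \<in> arcs G. tail G e = u \<and> head G e = w}"

definition adjacency_matrix :: "('v, 'e) pre_digraph \<Rightarrow> real mat" where
  "adjacency_matrix G = mat (card (verts G)) (card (verts G))
     (\<lambda>(i, j). real (num_edges G (vertex_list G ! i) (vertex_list G ! j)))"

definition perron_eigenvalue :: "real mat \<Rightarrow> real \<Rightarrow> bool" where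
  "perron_eigenvalue A l \<longleftrightarrow>
     eigenvalue A l \<and> l = spectral_radius (map_mat complex_of_real A)"

definition I_minus_Az :: "('v, 'e) pre_digraph \<Rightarrow> real \<Rightarrow> real mat" where
  "I_minus_Az G z = 1\<^sub>m (card (verts G)) - z \<cdot>\<^sub>m adjacency_matrix G"

definition p_det :: "('v, 'e) pre_digraph \<Rightarrow> real \<Rightarrow> real" where
  "p_det G z = Determinant.det (I_minus_Az G z)"

definition p_minor :: "('v, 'e) pre_digraph \<Rightarrow> 'v \<Rightarrow> real \<Rightarrow> real" where
  "p_minor G v z =
     Determinant.det (mat_delete (I_minus_Az G z) (vertex_index G v) (vertex_index G v))"

definition q_ratio :: "('v, 'e) pre_digraph \<Rightarrow> 'v \<Rightarrow> real \<Rightarrow> real" where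
  "q_ratio G v z = p_det G z / p_minor G v z"

end

theory Submission
  imports Defs "HOL-Analysis.Infinite_Sum" "Graph_Theory.Arc_Walk"
begin

text \<open>
  Fix a vertex $v$ and let $F$ be the generating function of the first-return loops at $v$.
  All loops at $v$ have generating function $1/(1-F)$, which Cramer's rule identifies with
  $p_v/p$ on $(0,\rho)$. Hence $q_v = 1 - F$ there, and $u := F(\rho^2)$ satisfies
  $u \le \rho F(\rho) \le \rho < 1/4$. So every vertex enters the maximum, with
  $s := \sqrt{q_v(\rho^2) - 3/4} = \sqrt{1/4 - u} > 0$.

  Suppose that $p_v(\rho) \ne 0$. Then $F(\rho) = 1$, and the mean length
  $\rho F'(\rho)$ of a first return, chosen with weights $\rho^{|a|}$, is at most
  $M := -\rho p'(\rho)/p_v(\rho)$. In $D_G$ a first-return loop $a$ may be walked up as $a^-$,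
  and at any visit to $v$ one may insert a Dyck word built from brackets $a^- \ldots a^+$. The
  Dyck words have the generating function $B$ with $B = 1 + F(x^2)B^2$, and the words made of
  ascending first returns with insertions have $1/(1 - B(x)F(x))$. So the entropy is at least
  $-\log x$ as soon as $B(x)F(x) \ge 1$. Take $x = \rho e^{-t/M}$ with $e^t = 1 + u$. Convexity of
  the exponential function gives $F(x) \ge e^{-t}$ and $F(x^2) \ge u e^{-2t}$, and the latter
  forces $B(x) \ge e^t$. The result is $h(D_G) \ge -\log\rho + \frac1M\log(1+u)$, and the term of $v$
  in the theorem is $\frac1M \cdot \frac{s(1/2-s)}{\rho+s} < \frac1M\log(1+u)$.

  If $p_v(\rho) = 0$, which can happen when $G$ is not strongly connected, the term of $v$ is
  $0$, and it remains to see that $h(D_G) > -\log\rho$. For this it is enough to allow a walk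
  to replace a step $e^-$ by $e^-e^+e^-$. An eigenvector for $\rho^{-1}$ then bounds the growth of the
  number of these words from below.

  That a word has nonzero product is shown by letting the graph inverse semigroup act on
  stacks of edges.
\<close>


section \<open>Subadditive sequences\<close>

lemma subadditive_mult_add:
  fixes a :: "nat \<Rightarrow> real"
  assumes sub: "\<And>m n. a (m + n) \<le> a m + a n"
  shows "a (q * m + r) \<le> real q * a m + a r"
proof (induction q)
  case (Suc q)
  have "a (Suc q * m + r) = a (m + (q * m + r))"
    by (simp add: algebra_simps)
  also have "\<dots> \<le> a m + (real q * a m + a r)"
    using sub[of m "q * m + r"] Suc by linarith
  finally show ?case
    by (simp add: algebra_simps)
qed auto

text \<open>
  Fekete's lemma: with $n = qm + r$ and $r < m$, subadditivity gives
  $a_n \le q\,a_m + \sum_{r<m} a_r$, so that $\limsup a_n/n \le a_m/m$ for every $m$; hence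
  the limit is the infimum of the quotients.
\<close>

lemma subadditive_convergent:
  fixes a :: "nat \<Rightarrow> real"
  assumes sub: "\<And>m n. a (m + n) \<le> a m + a n" and nonneg: "\<And>n. 0 \<le> a n"
  shows "convergent (\<lambda>n. a n / real n)"
proof -
  define I where "I = (INF n\<in>{1..}. a n / real n)"
  have bdd: "bdd_below ((\<lambda>n. a n / real n) ` {1..})"
    by (rule bdd_belowI[of _ 0]) (auto simp: nonneg)
  have "(\<lambda>n. a n / real n) \<longlonglongrightarrow> I"
  proof (rule order_tendstoI)
    fix c assume "c < I"
    have "eventually (\<lambda>n::nat. n \<ge> 1) sequentially"
      by (rule eventually_ge_at_top)
    then show "eventually (\<lambda>n. c < a n / real n) sequentially"
    proof eventually_elim
      case (elim n)
      then have "I \<le> a n / real n"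
        unfolding I_def by (intro cINF_lower bdd) auto
      with \<open>c < I\<close> show ?case by simp
    qed
  next
    fix c assume "I < c"
    then obtain m where m: "m \<ge> 1" "a m / real m < c"
      unfolding I_def by (subst (asm) cINF_less_iff[OF _ bdd]) auto
    define C where "C = (\<Sum>r<m. a r)"
    have C: "a r \<le> C" if "r < m" for r
      unfolding C_def using that by (intro member_le_sum) (auto simp: nonneg)
    have "(\<lambda>n. a m / real m + C / real n) \<longlonglongrightarrow> a m / real m + 0"
      by (intro tendsto_intros lim_const_over_n)
    then have "eventually (\<lambda>n. a m / real m + C / real n < c) sequentially"
      using m(2) by (intro order_tendstoD(2)) auto
    moreover have "eventually (\<lambda>n::nat. n \<ge> 1) sequentially"
      by (rule eventually_ge_at_top)
    ultimately show "eventually (\<lambda>n. a n / real n < c) sequentially"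
    proof eventually_elim
      case (elim n)
      have "a n \<le> real (n div m) * a m + a (n mod m)"
        using subadditive_mult_add[of a "n div m" m "n mod m"] sub by simp
      also have "\<dots> \<le> real n / real m * a m + C"
      proof (intro add_mono mult_right_mono nonneg)
        show "real (n div m) \<le> real n / real m"
          by (rule of_nat_div_le_of_nat)
        show "a (n mod m) \<le> C"
          using m(1) by (intro C) auto
      qed
      finally have "a n / real n \<le> (real n / real m * a m + C) / real n"
        by (rule divide_right_mono) simp
      also have "\<dots> = a m / real m + C / real n"
        using elim(2) by (simp add: field_simps)
      finally show ?case using elim(1) by simp
    qed
  qed
  then show ?thesis by (auto simp: convergent_def)
qed


section \<open>Entropy of a subshift and generating functions\<close>

definition gen_fun :: "'a list set \<Rightarrow> real \<Rightarrow> real" where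
  "gen_fun L x = (\<Sum>\<^sub>\<infinity>w\<in>L. x ^ length w)"

abbreviation gf_conv :: "'a list set \<Rightarrow> real \<Rightarrow> bool" where
  "gf_conv L x \<equiv> (\<lambda>w. x ^ length w) summable_on L"

lemma gf_conv_of_counts:
  assumes fin: "\<And>n. finite (L n)" and len: "\<And>n w. w \<in> L n \<Longrightarrow> length w = n"
    and x: "0 \<le> x" and summ: "summable (\<lambda>n. real (card (L n)) * x ^ n)"
  shows "gf_conv (\<Union>n. L n) x"
proof (rule nonneg_bdd_above_summable_on)
  show "bdd_above (sum (\<lambda>w. x ^ length w) ` {F. F \<subseteq> (\<Union>n. L n) \<and> finite F})"
  proof (rule bdd_aboveI2)
    fix F assume "F \<in> {F. F \<subseteq> (\<Union>n. L n) \<and> finite F}"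
    then have F: "F \<subseteq> (\<Union>n. L n)" "finite F" by auto
    define N where "N = Suc (Max (insert 0 (length ` F)))"
    have N: "length w < N" if "w \<in> F" for w
      unfolding N_def using F(2) that by (auto simp: less_Suc_eq_le intro!: Max_ge)
    have "F \<subseteq> (\<Union>n<N. L n)"
      using F(1) N len by fastforce
    then have "(\<Sum>w\<in>F. x ^ length w) \<le> (\<Sum>w\<in>(\<Union>n<N. L n). x ^ length w)"
      using x fin by (intro sum_mono2) auto
    also have "\<dots> = (\<Sum>n<N. \<Sum>w\<in>L n. x ^ length w)"
      using fin len by (subst sum.UNION_disjoint) (simp, simp, blast, simp)
    also have "\<dots> = (\<Sum>n<N. real (card (L n)) * x ^ n)"
      using len by (intro sum.cong) auto
    also have "\<dots> \<le> (\<Sum>n. real (card (L n)) * x ^ n)"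
      using x by (intro sum_le_suminf summ) auto
    finally show "(\<Sum>w\<in>F. x ^ length w) \<le> (\<Sum>n. real (card (L n)) * x ^ n)" .
  qed
qed (use x in auto)

lemma finite_language:
  assumes fin: "finite S" and X: "\<And>x. x \<in> X \<Longrightarrow> range x \<subseteq> S"
  shows "finite (language X n)"
proof (rule finite_subset)
  show "language X n \<subseteq> {w. set w \<subseteq> S \<and> length w = n}"
    using X by (fastforce simp: language_def)
qed (rule finite_lists_length_eq[OF fin])

lemma language_split:
  assumes "w \<in> language X (m + n)"
  shows "take m w \<in> language X m" "drop m w \<in> language X n"
proof -
  obtain x i where x: "x \<in> X" and w: "w = map (\<lambda>k. x (i + int k)) [0..<m + n]"
    using assms by (auto simp: language_def)
  have "take m w = map (\<lambda>k. x (i + int k)) [0..<m]"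
    by (simp add: w take_map)
  then show "take m w \<in> language X m"
    using x by (auto simp: language_def)
  have "drop m w = map (\<lambda>k. x ((i + int m) + int k)) [0..<n]"
    by (rule nth_equalityI) (auto simp: w add_ac)
  then show "drop m w \<in> language X n"
    using x unfolding language_def by blast
qed

text \<open>
  Cutting a word of length $m+n$ after $m$ letters shows that $\#\mathcal L_n(X)$ is
  submultiplicative, so that Fekete's lemma applies to its logarithm.
\<close>

lemma entropy_convergent:
  assumes fin: "finite S" and X: "\<And>x. x \<in> X \<Longrightarrow> range x \<subseteq> S" and ne: "X \<noteq> {}"
  shows "convergent (\<lambda>n. ln (real (card (language X n))) / real n)"
proof (rule subadditive_convergent)
  have pos: "card (language X n) > 0" for n
    using ne finite_language[OF fin X, of X n] by (auto simp: card_gt_0_iff language_def)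
  show "0 \<le> ln (real (card (language X n)))" for n
    using pos[of n] by simp
  fix m n
  have "card (language X (m + n)) \<le> card (language X m \<times> language X n)"
  proof (rule card_inj_on_le)
    show "inj_on (\<lambda>w. (take m w, drop m w)) (language X (m + n))"
      by (rule inj_onI) (metis append_take_drop_id prod.inject)
  qed (use language_split finite_language[OF fin X, of X] in auto)
  then have "real (card (language X (m + n))) \<le> real (card (language X m)) * real (card (language X n))"
    by (metis card_cartesian_product of_nat_le_iff of_nat_mult)
  then have "ln (real (card (language X (m + n)))) \<le> ln (real (card (language X m)) * real (card (language X n)))"
    using pos[of "m + n"] by (intro ln_mono) auto
  then show "ln (real (card (language X (m + n)))) \<le> ln (real (card (language X m))) + ln (real (card (language X n)))"
    using pos[of m] pos[of n] by (simp add: ln_mult)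
qed

text \<open>
  The radius of convergence of $\sum_n \#\mathcal L_n(X)\,x^n$ is $e^{-h(X)}$. So a family of
  words of the language whose generating function diverges at $x$ forces $h(X) \ge -\log x$.
\<close>

lemma entropy_ge_if_diverges:
  assumes fin: "finite S" and X: "\<And>x. x \<in> X \<Longrightarrow> range x \<subseteq> S" and ne: "X \<noteq> {}"
    and W: "\<And>w. w \<in> W \<Longrightarrow> w \<in> language X (length w)"
    and x: "0 < x" and div: "\<not> gf_conv W x"
  shows "- ln x \<le> topological_entropy X"
proof (rule ccontr)
  define c where "c n = card (language X n)" for n
  define h where "h = topological_entropy X"
  assume "\<not> - ln x \<le> topological_entropy X"
  then have "h < - ln x" by (simp add: h_def)
  then obtain b where b: "h < b" "b < - ln x" using dense by blast
  have pos: "c n > 0" for n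
    using ne finite_language[OF fin X, of X n] by (auto simp: c_def card_gt_0_iff language_def)
  have lim: "(\<lambda>n. ln (real (c n)) / real n) \<longlonglongrightarrow> h"
    using entropy_convergent[OF fin X ne]
    by (simp add: h_def topological_entropy_def c_def convergent_LIMSEQ_iff)
  have "summable (\<lambda>n. real (c n) * x ^ n)"
  proof (rule summable_comparison_test_ev)
    have "eventually (\<lambda>n. ln (real (c n)) / real n < b) sequentially"
      by (rule order_tendstoD(2)[OF lim b(1)])
    moreover have "eventually (\<lambda>n::nat. n \<ge> 1) sequentially"
      by (rule eventually_ge_at_top)
    ultimately show "eventually (\<lambda>n. norm (real (c n) * x ^ n) \<le> (exp b * x) ^ n) sequentially"
    proof eventually_elim
      case (elim n)
      then have "ln (real (c n)) < real n * b"
        by (simp add: field_simps)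
      then have "real (c n) \<le> exp (real n * b)"
        using pos[of n] by (metis exp_le_cancel_iff exp_ln less_imp_le of_nat_0_less_iff)
      then show ?case
        using x by (simp add: power_mult_distrib exp_of_nat_mult mult_right_mono)
    qed
    have "exp b * x < exp (- ln x) * x"
      using b x by simp
    also have "\<dots> = 1"
      using x by (simp add: exp_minus)
    finally show "summable (\<lambda>n. (exp b * x) ^ n)"
      using x by (intro summable_geometric) auto
  qed
  then have "gf_conv (\<Union>n. language X n) x"
    using x by (intro gf_conv_of_counts finite_language[OF fin X]) (auto simp: c_def language_def)
  then have "gf_conv W x"
    by (rule summable_on_subset_banach) (use W in auto)
  with div show False by simp
qed


section \<open>The stack representation of the graph inverse semigroup\<close>

text \<open>
  A state is a current vertex together with a stack of edges. The generators act as partial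
  maps: $e^-$ pushes $e$ while walking along it, $e^+$ pops $e$ while walking back. All
  defining relations hold for these partial maps, so a word whose action has nonempty domain
  has nonzero product. Popping also checks the current vertex, which makes
  $P_{r(e)}e^+ = e^+$ hold on every state, even if the stack does not fit the vertex.
\<close>

fun act :: "('v, 'e) pre_digraph \<Rightarrow> ('v, 'e) generator \<Rightarrow> 'v \<times> 'e list \<Rightarrow> ('v \<times> 'e list) option" where
  "act G Zero _ = None"
| "act G (Proj u) (v, s) = (if v = u then Some (v, s) else None)"
| "act G (Edge (Minus e)) (v, s) = (if v = tail G e then Some (head G e, e # s) else None)"
| "act G (Edge (Plus e)) (v, s) =
     (case s of [] \<Rightarrow> None | f # s' \<Rightarrow> if f = e \<and> v = head G e then Some (tail G e, s') else None)"

fun act_word :: "('v, 'e) pre_digraph \<Rightarrow> ('v, 'e) generator list \<Rightarrow> 'v \<times> 'e list \<Rightarrow> ('v \<times> 'e list) option" where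
  "act_word G [] q = Some q"
| "act_word G (x # w) q = Option.bind (act G x q) (act_word G w)"

lemma act_word_append:
  "act_word G (a @ b) q = Option.bind (act_word G a q) (act_word G b)"
proof (induction a arbitrary: q)
  case (Cons x a)
  then show ?case by (cases "act G x q") auto
qed auto

lemma gis_eq_act_word: "gis_eq G w w' \<Longrightarrow> act_word G w = act_word G w'"
proof (induction rule: gis_eq.induct)
  case (congr w w' a b)
  then have "act_word G (w @ b) = act_word G (w' @ b)"
    by (auto simp: act_word_append)
  then show ?case by (auto simp: act_word_append)
next
  case (zero_right x)
  show ?case
    by (rule ext) (auto split: option.splits bind_splits)
qed (auto simp: fun_eq_iff split: list.splits)

definition run :: "('v, 'e) pre_digraph \<Rightarrow> 'e signed_edge list \<Rightarrow> 'v \<times> 'e list \<Rightarrow> ('v \<times> 'e list) option" where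
  "run G w = act_word G (map Edge w)"

lemma run_Nil [simp]: "run G [] q = Some q"
  and run_Cons [simp]: "run G (x # w) q = Option.bind (act G (Edge x) q) (run G w)"
  by (auto simp: run_def)

lemma run_append: "run G (a @ b) q = Option.bind (run G a q) (run G b)"
  by (simp add: run_def act_word_append)

definition runnable :: "('v, 'e) pre_digraph \<Rightarrow> 'e signed_edge list \<Rightarrow> bool" where
  "runnable G w \<longleftrightarrow> (\<exists>q. run G w q \<noteq> None)"

lemma runnableI: "run G w q = Some q' \<Longrightarrow> runnable G w"
  unfolding runnable_def by (rule exI[of _ q]) simp

lemma runnable_nonzero: "runnable G w \<Longrightarrow> nonzero_product G w"
  unfolding runnable_def run_def nonzero_product_def by (auto dest!: gis_eq_act_word)

lemma runnable_factor: "runnable G (a @ w @ b) \<Longrightarrow> runnable G w"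
proof -
  assume "runnable G (a @ w @ b)"
  then obtain q where "Option.bind (run G a q) (\<lambda>q'. Option.bind (run G w q') (run G b)) \<noteq> None"
    unfolding runnable_def run_append by blast
  then obtain q' where "run G a q = Some q'" "run G w q' \<noteq> None"
    by (cases "run G a q"; cases "run G w (the (run G a q))") auto
  then show ?thesis unfolding runnable_def by blast
qed

lemma run_stack_append:
  "run G w (v, s) = Some (v', s') \<Longrightarrow> run G w (v, s @ r) = Some (v', s' @ r)"
proof (induction w arbitrary: v s)
  case (Cons x w)
  obtain v1 s1 where "act G (Edge x) (v, s) = Some (v1, s1)" "run G w (v1, s1) = Some (v', s')"
    using Cons.prems by (auto simp: bind_eq_Some_conv)
  moreover from this(1) have "act G (Edge x) (v, s @ r) = Some (v1, s1 @ r)"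
    by (cases x) (auto split: list.splits if_splits)
  ultimately show ?case
    using Cons.IH by auto
qed auto

fun flip :: "'e signed_edge \<Rightarrow> 'e signed_edge" where
  "flip (Minus e) = Plus e"
| "flip (Plus e) = Minus e"

lemma flip_flip [simp]: "flip (flip x) = x"
  by (cases x) auto

lemma flip_signed_edges [simp]: "flip x \<in> signed_edges G \<longleftrightarrow> x \<in> signed_edges G"
  by (cases x) (auto simp: signed_edges_def)

lemma runnable_snoc_flip:
  assumes "runnable G (w @ [x])"
  shows "runnable G (w @ [x, flip x])"
proof -
  obtain q where "run G (w @ [x]) q \<noteq> None"
    using assms by (auto simp: runnable_def)
  then obtain v s q' where "run G w q = Some (v, s)" "act G (Edge x) (v, s) = Some q'"
    unfolding run_append by (auto simp: bind_eq_Some_conv)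
  moreover from this(2) have "run G [x, flip x] (v, s) \<noteq> None"
    by (cases x) (auto split: list.splits if_splits)
  then obtain p where "run G [x, flip x] (v, s) = Some p" by blast
  ultimately have "run G (w @ [x, flip x]) q = Some p"
    by (simp only: run_append Option.bind.simps)
  then show ?thesis by (rule runnableI)
qed

lemma runnable_flip_Cons:
  assumes "runnable G (x # w)"
  shows "runnable G (flip x # x # w)"
proof -
  obtain v s q' where q: "act G (Edge x) (v, s) = Some q'" "run G w q' \<noteq> None"
    using assms by (auto simp: runnable_def bind_eq_Some_conv)
  have "\<exists>p. run G [flip x, x] p = Some q'"
  proof (cases x)
    case (Minus e)
    with q show ?thesis
      by (intro exI[of _ "(head G e, e # s)"]) (auto split: if_splits)
  next
    case (Plus e)
    with q show ?thesis
      by (intro exI[of _ "(tail G e, tl s)"]) (auto split: list.splits if_splits)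
  qed
  then obtain p where "run G [flip x, x] p = Some q'" ..
  then have "run G ([flip x, x] @ w) p = run G w q'"
    by (simp only: run_append Option.bind.simps)
  with q(2) obtain q'' where "run G ([flip x, x] @ w) p = Some q''" by auto
  from runnableI[OF this] show ?thesis by simp
qed

text \<open>
  A bi-infinite sequence in which a given word occurs at position $0$. To the left of the word
  its first letter and to the right its last letter is continued by the alternating sequence
  of $e^-$ and $e^+$.
\<close>

definition flip_ext :: "'e signed_edge list \<Rightarrow> int \<Rightarrow> 'e signed_edge" where
  "flip_ext w i =
     (if i < 0 then (if even i then hd w else flip (hd w))
      else if i < int (length w) then w ! nat i
      else (if even (i - int (length w)) then flip (last w) else last w))"

definition window :: "(int \<Rightarrow> 'a) \<Rightarrow> int \<Rightarrow> nat \<Rightarrow> 'a list" where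
  "window x i n = map (\<lambda>k. x (i + int k)) [0..<n]"

lemma window_add: "window x i (m + n) = window x i m @ window x (i + int m) n"
  by (rule nth_equalityI) (auto simp: window_def nth_append add_ac)

lemma window_1 [simp]: "window x i (Suc 0) = [x i]"
  by (simp add: window_def)

lemma window_flip_ext_self: "window (flip_ext w) 0 (length w) = w"
  by (rule nth_equalityI) (auto simp: window_def flip_ext_def)

lemma flip_ext_right:
  assumes "w \<noteq> []"
  shows "flip_ext w (int (length w + n)) = flip (flip_ext w (int (length w + n) - 1))"
proof (cases n)
  case 0
  have "nat (int (length w) - 1) = length w - 1" by simp
  with 0 assms show ?thesis
    by (simp add: flip_ext_def last_conv_nth)
next
  case (Suc m)
  then show ?thesis by (auto simp: flip_ext_def)
qed

lemma flip_ext_left: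
  assumes "w \<noteq> []"
  shows "flip_ext w (- int (Suc n)) = flip (flip_ext w (- int n))"
  using assms by (cases n) (auto simp: flip_ext_def hd_conv_nth)

lemma window_snoc: "window x i (Suc n) = window x i n @ [x (i + int n)]"
  by (simp add: window_def)

lemma window_Cons: "window x i (Suc n) = x i # window x (i + 1) n"
  using window_add[of x i 1 n] by simp

text \<open>
  Since $e^-e^+e^- = e^-$ and $e^+e^-e^+ = e^+$, a word stays runnable when its last letter
  is followed, and its first letter preceded, by an alternating sequence.
\<close>

lemma runnable_flip_ext:
  assumes "w \<noteq> []" "runnable G w"
  shows "runnable G (window (flip_ext w) (- int m) (m + length w + n))"
proof (induction m)
  case 0
  show ?case
  proof (induction n)
    case 0
    then show ?case using assms(2) by (simp add: window_flip_ext_self)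
  next
    case (Suc n)
    obtain k where k: "length w + n = Suc k"
      using assms(1) by (cases "length w + n") auto
    have "flip_ext w (int (Suc k)) = flip (flip_ext w (int k))"
      using flip_ext_right[OF assms(1), of n] k by simp
    with Suc k show ?case
      using runnable_snoc_flip[of G "window (flip_ext w) 0 k" "flip_ext w (int k)"]
      by (simp add: window_snoc)
  qed
next
  case (Suc m)
  obtain k where k: "m + length w + n = Suc k"
    using assms(1) by (cases "m + length w + n") auto
  have "runnable G (flip_ext w (- int m) # window (flip_ext w) (- int m + 1) k)"
    using Suc k by (simp add: window_Cons)
  from runnable_flip_Cons[OF this]
  have "runnable G (flip_ext w (- int (Suc m)) # window (flip_ext w) (- int m) (Suc k))"
    by (simp only: window_Cons flip_ext_left[OF assms(1), of m])
  with k show ?case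
    using window_Cons[of "flip_ext w" "- int (Suc m)" "Suc k"] by simp
qed

lemma flip_ext_in_shift:
  assumes "w \<noteq> []" "runnable G w" "set w \<subseteq> signed_edges G"
  shows "flip_ext w \<in> markov_dyck_shift G"
proof -
  have "runnable G (window (flip_ext w) i n)" for i n
  proof -
    define m where "m = nat (max 0 (- i))"
    define p where "p = nat (i + int m)"
    have i: "i = - int m + int p"
      by (simp add: m_def p_def)
    have "runnable G (window (flip_ext w) (- int m) (m + length w + (p + n)))"
      by (rule runnable_flip_ext[OF assms(1,2)])
    moreover have "m + length w + (p + n) = p + (n + (m + length w))" by simp
    ultimately have "runnable G (window (flip_ext w) (- int m) p @ window (flip_ext w) i n
      @ window (flip_ext w) (i + int n) (m + length w))"
      by (simp only: window_add[of _ _ p] window_add[of _ _ n] i[symmetric])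
    then show ?thesis by (rule runnable_factor)
  qed
  moreover have "hd w \<in> signed_edges G" "last w \<in> signed_edges G"
    using assms(1,3) hd_in_set[OF assms(1)] last_in_set[OF assms(1)] by (simp_all add: subset_iff)
  then have "flip_ext w i \<in> signed_edges G" for i
    using assms(3) by (auto simp: flip_ext_def)
  ultimately show ?thesis
    by (auto simp: markov_dyck_shift_def window_def intro!: runnable_nonzero)
qed

lemma runnable_in_language:
  assumes "arcs G \<noteq> {}" "runnable G w" "set w \<subseteq> signed_edges G"
  shows "w \<in> language (markov_dyck_shift G) (length w)"
proof (cases "w = []")
  case False
  then have "flip_ext w \<in> markov_dyck_shift G"
    using assms by (intro flip_ext_in_shift)
  moreover have "w = map (\<lambda>k. flip_ext w (0 + int k)) [0..<length w]"
    using window_flip_ext_self[of w] by (simp add: window_def)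
  ultimately show ?thesis
    unfolding language_def by blast
next
  case True
  obtain e where e: "e \<in> arcs G" using assms(1) by blast
  then have "flip_ext [Minus e] \<in> markov_dyck_shift G"
    by (intro flip_ext_in_shift)
      (auto simp: signed_edges_def runnable_def intro!: exI[of _ "tail G e"])
  with True show ?thesis by (auto simp: language_def)
qed

lemma (in fin_digraph) markov_dyck_entropy_ge:
  assumes ne: "arcs G \<noteq> {}"
    and W: "\<And>w. w \<in> W \<Longrightarrow> runnable G w \<and> set w \<subseteq> signed_edges G"
    and x: "0 < x" and div: "\<not> gf_conv W x"
  shows "- ln x \<le> topological_entropy (markov_dyck_shift G)"
proof (rule entropy_ge_if_diverges[OF _ _ _ _ x div])
  show "finite (signed_edges G)"
    by (simp add: signed_edges_def)
  show "range x \<subseteq> signed_edges G" if "x \<in> markov_dyck_shift G" for x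
    using that by (auto simp: markov_dyck_shift_def)
  show "markov_dyck_shift G \<noteq> {}"
    using runnable_in_language[OF ne, of "[]"] by (auto simp: language_def runnable_def)
  show "w \<in> language (markov_dyck_shift G) (length w)" if "w \<in> W" for w
    using W[OF that] ne by (intro runnable_in_language) auto
qed


section \<open>Products of generating functions\<close>

lemma gen_fun_nonneg: "0 \<le> x \<Longrightarrow> 0 \<le> gen_fun L x"
  unfolding gen_fun_def by (intro infsum_nonneg) auto

lemma gf_conv_subset: "gf_conv L x \<Longrightarrow> L' \<subseteq> L \<Longrightarrow> gf_conv L' x"
  by (rule summable_on_subset_banach)

lemma gf_conv_mono: "gf_conv L y \<Longrightarrow> 0 \<le> x \<Longrightarrow> x \<le> y \<Longrightarrow> gf_conv L x"
  by (rule summable_on_comparison_test) (auto intro: power_mono)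

lemma gen_fun_mono:
  "gf_conv L y \<Longrightarrow> 0 \<le> x \<Longrightarrow> x \<le> y \<Longrightarrow> gen_fun L x \<le> gen_fun L y"
  unfolding gen_fun_def by (rule infsum_mono) (auto intro: power_mono gf_conv_mono)

lemma gen_fun_ge_finite:
  "gf_conv L x \<Longrightarrow> 0 \<le> x \<Longrightarrow> finite S \<Longrightarrow> S \<subseteq> L \<Longrightarrow> (\<Sum>w\<in>S. x ^ length w) \<le> gen_fun L x"
  unfolding gen_fun_def by (rule finite_sum_le_infsum) auto

lemma gen_fun_ge_one: "gf_conv L x \<Longrightarrow> 0 \<le> x \<Longrightarrow> [] \<in> L \<Longrightarrow> 1 \<le> gen_fun L x"
  using gen_fun_ge_finite[of x L "{[]}"] by auto

lemma gen_fun_pos_if_nonempty: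
  assumes "gf_conv L x" "0 < x" "L \<noteq> {}"
  shows "0 < gen_fun L x"
proof -
  obtain w where "w \<in> L" using assms(3) by blast
  then have "x ^ length w \<le> gen_fun L x"
    using gen_fun_ge_finite[OF assms(1), of "{w}"] assms(2) by auto
  with assms(2) show ?thesis
    by (meson less_le_trans zero_less_power)
qed

lemma gen_fun_insert_Nil:
  "gf_conv L x \<Longrightarrow> [] \<notin> L \<Longrightarrow> gen_fun (insert [] L) x = 1 + gen_fun L x"
  unfolding gen_fun_def by (subst infsum_insert) auto

lemma infsum_Times_mult:
  fixes f :: "'a \<Rightarrow> real" and g :: "'b \<Rightarrow> real"
  assumes "(\<lambda>(a, b). f a * g b) summable_on A \<times> B"
  shows "(\<Sum>\<^sub>\<infinity>(a, b)\<in>A \<times> B. f a * g b) = infsum f A * infsum g B"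
proof -
  have "(\<Sum>\<^sub>\<infinity>(a, b)\<in>A \<times> B. f a * g b) = (\<Sum>\<^sub>\<infinity>a\<in>A. \<Sum>\<^sub>\<infinity>b\<in>B. f a * g b)"
    using infsum_Sigma_banach[OF assms] by simp
  also have "\<dots> = infsum f A * infsum g B"
    by (simp only: infsum_cmult_right' infsum_cmult_left')
  finally show ?thesis .
qed

text \<open>
  Unique factorization turns a generating function into a product. The weights $f$ and $g$ are
  left open because the first factor may be written twice, once as $a^-$ and once as $a^+$.
\<close>

lemma gen_fun_image_pair:
  assumes inj: "inj_on (\<lambda>(a, b). h a b) (A \<times> B)"
    and len: "\<And>a b. a \<in> A \<Longrightarrow> b \<in> B \<Longrightarrow> x ^ length (h a b) = f a * g b"
    and conv: "gf_conv ((\<lambda>(a, b). h a b) ` (A \<times> B)) x"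
  shows "gen_fun ((\<lambda>(a, b). h a b) ` (A \<times> B)) x = infsum f A * infsum g B"
proof -
  have eq: "((\<lambda>w. x ^ length w) \<circ> (\<lambda>(a, b). h a b)) z = (\<lambda>(a, b). f a * g b) z" if "z \<in> A \<times> B" for z
    using that len by auto
  have "(\<lambda>(a, b). f a * g b) summable_on A \<times> B"
    using conv eq by (simp add: summable_on_reindex[OF inj] cong: summable_on_cong)
  note prod = infsum_Times_mult[OF this]
  have "gen_fun ((\<lambda>(a, b). h a b) ` (A \<times> B)) x = (\<Sum>\<^sub>\<infinity>(a, b)\<in>A \<times> B. f a * g b)"
    unfolding gen_fun_def infsum_reindex[OF inj] by (rule infsum_cong[OF eq])
  with prod show ?thesis by simp
qed

lemma gen_fun_image_Sigma:
  assumes inj: "inj_on h (Sigma I T)" and fin: "finite I"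
    and len: "\<And>i t. x ^ length (h (i, t)) = f i * x ^ length t"
    and conv: "gf_conv (h ` Sigma I T) x"
  shows "gen_fun (h ` Sigma I T) x = (\<Sum>i\<in>I. f i * gen_fun (T i) x)"
proof -
  have "gen_fun (h ` Sigma I T) x = infsum ((\<lambda>w. x ^ length w) \<circ> h) (Sigma I T)"
    unfolding gen_fun_def by (rule infsum_reindex[OF inj])
  also have "\<dots> = (\<Sum>\<^sub>\<infinity>i\<in>I. \<Sum>\<^sub>\<infinity>t\<in>T i. ((\<lambda>w. x ^ length w) \<circ> h) (i, t))"
    using conv by (subst infsum_Sigma_banach) (simp_all add: summable_on_reindex[OF inj])
  also have "\<dots> = (\<Sum>i\<in>I. f i * gen_fun (T i) x)"
    using fin by (simp add: len infsum_cmult_right' gen_fun_def)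
  finally show ?thesis .
qed


section \<open>First-return loops\<close>

context fin_digraph
begin

definition loops :: "'a \<Rightarrow> 'b list set" where
  "loops v = {p. awalk v p v}"

text \<open>
  A loop returns to $v$ for the first time at its end iff it has no proper nonempty prefix that
  is a loop at $v$. In this form the first returns are the irreducible elements of the monoid of
  loops, and they are visibly a prefix code.
\<close>

definition first_returns :: "'a \<Rightarrow> 'b list set" where
  "first_returns v = {a \<in> loops v. a \<noteq> [] \<and> (\<forall>b c. a = b @ c \<longrightarrow> b \<in> loops v \<longrightarrow> b = [] \<or> c = [])}"

lemma awalk_appendD:
  assumes "awalk u (p @ q) w" "awalk u p v"
  shows "awalk v q w"
  using assms by (auto simp: awlast_of_awalk)

lemma loops_append: "a \<in> loops v \<Longrightarrow> b \<in> loops v \<Longrightarrow> a @ b \<in> loops v"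
  unfolding loops_def by (auto intro: awalk_appendI simp del: awalk_append_iff)

lemma loops_appendD: "a @ b \<in> loops v \<Longrightarrow> a \<in> loops v \<Longrightarrow> b \<in> loops v"
  unfolding loops_def by (auto intro: awalk_appendD simp del: awalk_append_iff)

lemma first_returns_loops: "first_returns v \<subseteq> loops v - {[]}"
  by (auto simp: first_returns_def)

text \<open>The first factor is the shortest nonempty prefix that is a loop at $v$.\<close>

lemma first_return_decomposition:
  assumes "p \<in> loops v" "p \<noteq> []"
  shows "\<exists>a q. a \<in> first_returns v \<and> q \<in> loops v \<and> p = a @ q"
proof -
  define n where "n = (LEAST n. n > 0 \<and> n \<le> length p \<and> take n p \<in> loops v)"
  have ex: "length p > 0 \<and> length p \<le> length p \<and> take (length p) p \<in> loops v"
    using assms by simp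
  have n: "n > 0 \<and> n \<le> length p \<and> take n p \<in> loops v"
    unfolding n_def using ex by (rule LeastI)
  have min: "\<not> (m > 0 \<and> m \<le> length p \<and> take m p \<in> loops v)" if "m < n" for m
    using not_less_Least[OF that[unfolded n_def]] .
  have "take n p \<in> first_returns v"
    unfolding first_returns_def
  proof (intro CollectI conjI allI impI)
    show "take n p \<noteq> []" using n assms(2) by auto
    fix b c assume bc: "take n p = b @ c" "b \<in> loops v"
    have len: "length b + length c = n"
      using arg_cong[OF bc(1), of length] n by simp
    have "take (length b) (take n p) = b"
      by (simp add: bc(1))
    with len have "b = take (length b) p"
      by (simp add: min_def split: if_splits)
    then show "b = [] \<or> c = []"
      using len min[of "length b"] bc(2) n by (cases "c = []") auto
  qed (use n in auto)
  moreover have "drop n p \<in> loops v"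
    using n assms(1) loops_appendD[of "take n p" "drop n p" v] by simp
  ultimately show ?thesis
    by (metis append_take_drop_id)
qed

lemma first_returns_prefix_code:
  assumes "a \<in> first_returns v" "a' \<in> first_returns v" "a @ x = a' @ y"
  shows "a = a'"
proof -
  have *: "a = a'" if "a \<in> first_returns v" "a' \<in> first_returns v" "a = a' @ c" for a a' c
    using that unfolding first_returns_def by auto
  from assms(3) have "(\<exists>c. a = a' @ c) \<or> (\<exists>c. a' = a @ c)"
    unfolding append_eq_append_conv2 by blast
  then show ?thesis
    using *[OF assms(1,2)] *[OF assms(2,1)] by blast
qed

text \<open>
  A nonempty loop factors into a first return and a loop, and in only one way because the first
  returns form a prefix code.
\<close>

lemma renewal_equation:
  assumes "v \<in> verts G" "gf_conv (loops v) x"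
  shows "gen_fun (loops v) x = 1 + gen_fun (first_returns v) x * gen_fun (loops v) x"
proof -
  let ?h = "\<lambda>(a, p). a @ p" and ?P = "first_returns v \<times> loops v"
  have inj: "inj_on ?h ?P"
    by (rule inj_onI) (auto dest: first_returns_prefix_code)
  have eq: "loops v = insert [] (?h ` ?P)"
  proof (intro equalityI subsetI)
    fix p assume "p \<in> loops v"
    then show "p \<in> insert [] (?h ` ?P)"
      using first_return_decomposition[of p v] by force
  next
    fix p assume "p \<in> insert [] (?h ` ?P)"
    then show "p \<in> loops v"
      using assms(1) first_returns_loops[of v] loops_append
      by (auto simp: loops_def awalk_Nil_iff)
  qed
  have conv: "gf_conv (?h ` ?P) x"
    by (rule gf_conv_subset[OF assms(2)]) (use eq in blast)
  have "gen_fun (loops v) x = 1 + gen_fun (?h ` ?P) x"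
    using first_returns_loops[of v] conv by (subst eq, subst gen_fun_insert_Nil) auto
  also have "gen_fun (?h ` ?P) x = gen_fun (first_returns v) x * gen_fun (loops v) x"
    using gen_fun_image_pair[OF inj _ conv, of "\<lambda>a. x ^ length a" "\<lambda>a. x ^ length a"]
    by (simp add: power_add gen_fun_def)
  finally show ?thesis .
qed

lemma first_returns_gen_fun:
  assumes "v \<in> verts G" "gf_conv (loops v) x" "0 \<le> x"
  shows "gen_fun (first_returns v) x = 1 - 1 / gen_fun (loops v) x"
    and "gen_fun (first_returns v) x < 1"
proof -
  have ge: "1 \<le> gen_fun (loops v) x"
    using assms by (intro gen_fun_ge_one) (auto simp: loops_def awalk_Nil_iff)
  show 1: "gen_fun (first_returns v) x = 1 - 1 / gen_fun (loops v) x"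
    using renewal_equation[OF assms(1,2)] ge by (simp add: field_simps)
  show "gen_fun (first_returns v) x < 1"
    unfolding 1 using ge by simp
qed

end


section \<open>Words with nonzero product built from first returns\<close>

lemma summable_on_Times_mult:
  fixes f :: "'a \<Rightarrow> real" and g :: "'b \<Rightarrow> real"
  assumes "f summable_on A" "g summable_on B" "\<And>a. 0 \<le> f a" "\<And>b. 0 \<le> g b"
  shows "(\<lambda>(a, b). f a * g b) summable_on A \<times> B"
proof (rule summable_on_SigmaI)
  show "((\<lambda>b. case (a, b) of (a, b) \<Rightarrow> f a * g b) has_sum f a * infsum g B) B" for a
    using has_sum_cmult_right[OF has_sum_infsum[OF assms(2)]] by simp
  show "(\<lambda>a. f a * infsum g B) summable_on A"
    by (rule summable_on_cmult_left[OF assms(1)])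
qed (use assms in auto)

abbreviation ascent :: "'e list \<Rightarrow> 'e signed_edge list" where
  "ascent a \<equiv> map Minus a"

abbreviation descent :: "'e list \<Rightarrow> 'e signed_edge list" where
  "descent a \<equiv> map Plus (rev a)"

context fin_digraph
begin

lemma run_ascent: "awalk u a w \<Longrightarrow> run G (ascent a) (u, s) = Some (w, rev a @ s)"
  by (induction a arbitrary: u s) (auto simp: awalk_simps)

lemma run_descent: "awalk u a w \<Longrightarrow> run G (descent a) (w, rev a @ s) = Some (u, s)"
proof (induction a arbitrary: u s)
  case (Cons e a)
  then have "run G (descent a) (w, rev a @ e # s) = Some (head G e, e # s)"
    by (simp add: awalk_Cons_iff)
  moreover have "tail G e = u"
    using Cons.prems by (simp add: awalk_Cons_iff)
  ultimately show ?case
    by (simp add: run_append)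
qed (auto simp: awalk_simps)

text \<open>
  Dyck words at $v$ act as the identity on the states at $v$. Their brackets are whole
  first-return loops, so that only the generating function of the first returns enters. A
  rising word is a sequence of first returns walked upwards, each preceded by a Dyck word.
\<close>

inductive_set dyck_words :: "'a \<Rightarrow> 'b signed_edge list set" for v where
  dyck_Nil: "[] \<in> dyck_words v"
| dyck_bracket: "a \<in> first_returns v \<Longrightarrow> b \<in> dyck_words v \<Longrightarrow> b' \<in> dyck_words v \<Longrightarrow>
    ascent a @ b @ descent a @ b' \<in> dyck_words v"

inductive_set rising_words :: "'a \<Rightarrow> 'b signed_edge list set" for v where
  rising_Nil: "[] \<in> rising_words v"
| rising_step: "b \<in> dyck_words v \<Longrightarrow> a \<in> first_returns v \<Longrightarrow> w \<in> rising_words v \<Longrightarrow>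
    b @ ascent a @ w \<in> rising_words v"

lemma first_returnsD: "a \<in> first_returns v \<Longrightarrow> awalk v a v \<and> a \<noteq> [] \<and> set a \<subseteq> arcs G"
  by (auto simp: first_returns_def loops_def)

lemma run_dyck_word: "b \<in> dyck_words v \<Longrightarrow> run G b (v, s) = Some (v, s)"
  by (induction b arbitrary: s rule: dyck_words.induct)
    (auto dest!: first_returnsD simp: run_append run_ascent run_descent)

lemma run_rising_word: "w \<in> rising_words v \<Longrightarrow> \<exists>r. run G w (v, s) = Some (v, r @ s)"
proof (induction w arbitrary: s rule: rising_words.induct)
  case (rising_step b a w)
  obtain r where "run G w (v, rev a @ s) = Some (v, r @ rev a @ s)"
    using rising_step.IH by blast
  with rising_step.hyps show ?case
    by (intro exI[of _ "r @ rev a"])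
      (auto dest!: first_returnsD simp: run_append run_ascent run_dyck_word)
qed auto

lemma dyck_words_letters: "b \<in> dyck_words v \<Longrightarrow> set b \<subseteq> signed_edges G"
  by (induction b rule: dyck_words.induct) (auto dest!: first_returnsD simp: signed_edges_def)

lemma rising_words_letters: "w \<in> rising_words v \<Longrightarrow> set w \<subseteq> signed_edges G"
proof (induction w rule: rising_words.induct)
  case (rising_step b a w)
  then show ?case
    using dyck_words_letters[of b v] first_returnsD[of a v] by (auto simp: signed_edges_def)
qed auto

text \<open>
  The first factor is recovered as the longest prefix that runs on the empty stack:
  the letter after it pops an edge.
\<close>

lemma dyck_word_before_descent_unique:
  assumes b: "b \<in> dyck_words v" "b' \<in> dyck_words v" and a: "a \<noteq> []" "a' \<noteq> []"
    and eq: "b @ descent a @ x = b' @ descent a' @ y"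
  shows "b = b'"
proof -
  have *: "b = b'"
    if b: "b \<in> dyck_words v" "b' \<in> dyck_words v" and a: "a \<noteq> []" and c: "b' = b @ c" "descent a @ x = c @ z"
    for b b' a c x z
  proof (cases c)
    case (Cons l c')
    obtain e a0 where "rev a = e # a0" using a by (cases "rev a") auto
    then have "run G c (v, []) = None"
      using c(2) Cons by auto
    then have "run G b' (v, []) = None"
      by (simp add: c(1) run_append run_dyck_word[OF b(1)])
    with run_dyck_word[OF b(2)] show ?thesis by simp
  qed (use c in auto)
  from eq have "(\<exists>c. b' = b @ c \<and> descent a @ x = c @ descent a' @ y) \<or>
      (\<exists>c. b = b' @ c \<and> descent a' @ y = c @ descent a @ x)"
    unfolding append_eq_append_conv2 by metis
  then show ?thesis
    using *[OF b a(1)] *[OF b(2,1) a(2)] by blast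
qed

text \<open>
  Here the first factor is recovered as the longest prefix that restores the empty stack:
  the edges pushed after it are never popped again.
\<close>

lemma dyck_word_before_ascent_unique:
  assumes b: "b \<in> dyck_words v" "b' \<in> dyck_words v"
    and a: "a \<in> first_returns v" "a' \<in> first_returns v"
    and w: "w \<in> rising_words v" "w' \<in> rising_words v"
    and eq: "b @ ascent a @ w = b' @ ascent a' @ w'"
  shows "b = b'"
proof -
  have *: "b = b'"
    if b: "b \<in> dyck_words v" "b' \<in> dyck_words v" and a: "a \<in> first_returns v"
      and w: "w \<in> rising_words v" and c: "b' = b @ c" "ascent a @ w = c @ z" for b b' a w c z
  proof (rule ccontr)
    assume "b \<noteq> b'"
    with c have "c \<noteq> []" by auto
    have c_run: "run G c (v, []) = Some (v, [])"
      using run_dyck_word[OF b(2), of "[]"] by (simp add: c(1) run_append run_dyck_word[OF b(1)])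
    note a' = first_returnsD[OF a]
    from c(2) have "(\<exists>d. ascent a = c @ d) \<or> (\<exists>d. c = ascent a @ d \<and> w = d @ z)"
      unfolding append_eq_append_conv2 by metis
    then show False
    proof (elim disjE exE conjE)
      fix d assume "ascent a = c @ d"
      then obtain c' d' where c': "c = ascent c'" "a = c' @ d'"
        by (metis map_eq_append_conv)
      have "awalk v c' (awlast v c')"
        using a' by (simp add: c'(2))
      from run_ascent[OF this] c_run \<open>c \<noteq> []\<close> show False
        by (simp add: c'(1))
    next
      fix d assume d: "c = ascent a @ d" "w = d @ z"
      obtain q where "run G w (v, []) = Some q"
        using run_rising_word[OF w, of "[]"] by auto
      then obtain u s where "run G d (v, []) = Some (u, s)"
        unfolding d(2) run_append by (cases "run G d (v, [])") auto
      then have "run G d (v, rev a) = Some (u, s @ rev a)"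
        using run_stack_append[of G d v "[]" u s "rev a"] by simp
      then have "run G c (v, []) = Some (u, s @ rev a)"
        by (simp add: d(1) run_append run_ascent[OF conjunct1[OF a']])
      with c_run a' show False by simp
    qed
  qed
  from eq have "(\<exists>c. b' = b @ c \<and> ascent a @ w = c @ ascent a' @ w') \<or>
      (\<exists>c. b = b' @ c \<and> ascent a' @ w' = c @ ascent a @ w)"
    unfolding append_eq_append_conv2 by metis
  then show ?thesis
    using *[OF b a(1) w(1)] *[OF b(2,1) a(2) w(2)] by blast
qed

lemma ascent_prefix_unique:
  assumes "a \<in> first_returns v" "a' \<in> first_returns v" "ascent a @ x = ascent a' @ y"
  shows "a = a'"
proof -
  have "(\<exists>c. ascent a' = ascent a @ c) \<or> (\<exists>c. ascent a = ascent a' @ c)"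
    using assms(3) unfolding append_eq_append_conv2 by metis
  then obtain c where "a' = a @ c \<or> a = a' @ c"
    by (metis inj_map_eq_map injI map_eq_append_conv signed_edge.inject(1))
  then show ?thesis
    using first_returns_prefix_code[OF assms(1,2), of c "[]"]
      first_returns_prefix_code[OF assms(1,2), of "[]" c] by auto
qed

text \<open>
  A nonempty Dyck word is $a^-\,b\,a^+\,b'$ with unique $a$, $b$, $b'$: first $a$ is determined
  because first returns form a prefix code, then $b$ as the part before the matching descent.
  The letters of $a$ occur twice, hence the argument $x^2$.
\<close>

lemma dyck_words_gen_fun:
  assumes x: "0 \<le> x" and conv: "gf_conv (dyck_words v) x"
  shows "gen_fun (dyck_words v) x = 1 + gen_fun (first_returns v) (x\<^sup>2) * (gen_fun (dyck_words v) x)\<^sup>2"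
proof -
  let ?D = "dyck_words v"
  let ?h = "\<lambda>(a, p). ascent a @ fst p @ descent a @ snd p" and ?P = "first_returns v \<times> (?D \<times> ?D)"
  have inj: "inj_on ?h ?P"
  proof (rule inj_onI, clarsimp)
    fix a b c a' b' c'
    assume *: "a \<in> first_returns v" "a' \<in> first_returns v"
      "b \<in> ?D" "b' \<in> ?D" "ascent a @ b @ descent a @ c = ascent a' @ b' @ descent a' @ c'"
    then have "a = a'" by (metis ascent_prefix_unique)
    moreover from this * have "b = b'"
      by (intro dyck_word_before_descent_unique[of b v b' a a' c c']) (auto dest: first_returnsD)
    ultimately show "a = a' \<and> b = b' \<and> c = c'" using * by simp
  qed
  have eq: "?D = insert [] (?h ` ?P)"
  proof (intro equalityI subsetI)
    fix w assume "w \<in> ?D"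
    then show "w \<in> insert [] (?h ` ?P)"
      by cases force+
  qed (auto intro: dyck_words.intros)
  have conv': "gf_conv (?h ` ?P) x"
    by (rule gf_conv_subset[OF conv]) (use eq in blast)
  have "gen_fun ?D x = 1 + gen_fun (?h ` ?P) x"
    using conv' by (subst eq, subst gen_fun_insert_Nil) (auto dest: first_returnsD)
  also have "gen_fun (?h ` ?P) x =
      (\<Sum>\<^sub>\<infinity>a\<in>first_returns v. (x\<^sup>2) ^ length a) * (\<Sum>\<^sub>\<infinity>(b, b')\<in>?D \<times> ?D. x ^ length b * x ^ length b')"
    by (rule gen_fun_image_pair[OF inj _ conv'])
      (auto simp: power_add power2_eq_square power_mult_distrib)
  also have "(\<Sum>\<^sub>\<infinity>(b, b')\<in>?D \<times> ?D. x ^ length b * x ^ length b') = (gen_fun ?D x)\<^sup>2"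
    using infsum_Times_mult[OF summable_on_Times_mult[OF conv conv]] x
    by (simp add: gen_fun_def power2_eq_square)
  finally show ?thesis
    by (simp add: gen_fun_def)
qed

lemma rising_words_gen_fun:
  assumes x: "0 \<le> x" and conv: "gf_conv (dyck_words v) x" "gf_conv (rising_words v) x"
    "gf_conv (first_returns v) x"
  shows "gen_fun (rising_words v) x =
    1 + gen_fun (dyck_words v) x * gen_fun (first_returns v) x * gen_fun (rising_words v) x"
proof -
  let ?D = "dyck_words v" and ?R = "first_returns v" and ?W = "rising_words v"
  let ?h = "\<lambda>(p, w). fst p @ ascent (snd p) @ w" and ?P = "(?D \<times> ?R) \<times> ?W"
  have inj: "inj_on ?h ?P"
  proof (rule inj_onI, clarsimp)
    fix b a w b' a' w'
    assume *: "a \<in> ?R" "a' \<in> ?R" "b \<in> ?D" "b' \<in> ?D" "w \<in> ?W" "w' \<in> ?W"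
      and e: "b @ ascent a @ w = b' @ ascent a' @ w'"
    from * e have "b = b'" by (metis dyck_word_before_ascent_unique)
    with e have "ascent a @ w = ascent a' @ w'" by simp
    with * have "a = a'" by (metis ascent_prefix_unique)
    with e \<open>b = b'\<close> show "b = b' \<and> a = a' \<and> w = w'" by simp
  qed
  have eq: "?W = insert [] (?h ` ?P)"
  proof (intro equalityI subsetI)
    fix w assume "w \<in> ?W"
    then show "w \<in> insert [] (?h ` ?P)"
      by cases force+
  qed (auto intro: rising_words.intros)
  have conv': "gf_conv (?h ` ?P) x"
    by (rule gf_conv_subset[OF conv(2)]) (use eq in blast)
  have "gen_fun ?W x = 1 + gen_fun (?h ` ?P) x"
    using conv' by (subst eq, subst gen_fun_insert_Nil) (auto dest: first_returnsD)
  also have "gen_fun (?h ` ?P) x =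
      (\<Sum>\<^sub>\<infinity>(b, a)\<in>?D \<times> ?R. x ^ length b * x ^ length a) * (\<Sum>\<^sub>\<infinity>w\<in>?W. x ^ length w)"
    by (rule gen_fun_image_pair[OF inj _ conv']) (auto simp: power_add)
  also have "(\<Sum>\<^sub>\<infinity>(b, a)\<in>?D \<times> ?R. x ^ length b * x ^ length a) = gen_fun ?D x * gen_fun ?R x"
    using infsum_Times_mult[OF summable_on_Times_mult[OF conv(1,3)]] x
    by (simp add: gen_fun_def)
  finally show ?thesis
    by (simp add: gen_fun_def)
qed

text \<open>
  If the generating functions $B$ of the Dyck words and $W$ of the rising words converged
  at $x$, then $W = 1 + BFW$ with finite $W > 0$ would force $BF < 1$.
\<close>

lemma entropy_ge_by_dyck_insertions:
  assumes ne: "arcs G \<noteq> {}" and x: "0 < x" and conv: "gf_conv (first_returns v) x"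
    and large: "\<And>B. 1 \<le> B \<Longrightarrow> B = 1 + gen_fun (first_returns v) (x\<^sup>2) * B\<^sup>2 \<Longrightarrow>
      1 \<le> B * gen_fun (first_returns v) x"
  shows "- ln x \<le> topological_entropy (markov_dyck_shift G)"
proof (rule markov_dyck_entropy_ge[OF ne _ x])
  let ?W = "dyck_words v \<union> rising_words v"
  show "runnable G w \<and> set w \<subseteq> signed_edges G" if "w \<in> ?W" for w
    using that run_dyck_word[of w v "[]"] run_rising_word[of w v "[]"]
      dyck_words_letters[of w v] rising_words_letters[of w v] by (auto intro: runnableI)
  show "\<not> gf_conv ?W x"
  proof
    assume "gf_conv ?W x"
    then have D: "gf_conv (dyck_words v) x" and W: "gf_conv (rising_words v) x"
      by (auto intro: gf_conv_subset)
    have "1 \<le> gen_fun (dyck_words v) x"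
      using D x by (intro gen_fun_ge_one) (auto intro: dyck_Nil)
    then have "1 \<le> gen_fun (dyck_words v) x * gen_fun (first_returns v) x"
      using dyck_words_gen_fun[OF _ D] x by (intro large) auto
    moreover have "0 \<le> gen_fun (rising_words v) x"
      using x by (intro gen_fun_nonneg) auto
    ultimately have "gen_fun (rising_words v) x \<le>
        gen_fun (dyck_words v) x * gen_fun (first_returns v) x * gen_fun (rising_words v) x"
      by (metis mult_1 mult_right_mono)
    with rising_words_gen_fun[OF _ D W conv] x show False by simp
  qed
qed


section \<open>Walks with spikes\<close>

text \<open>
  In a spiked walk each step $e^-$ may be replaced by $e^-e^+e^-$, which acts in the same way. So
  an edge contributes $x + x^3$ instead of $x$ to the generating function. The two versions of a
  step are told apart by the letter after $e^-$, since no spiked walk begins with a descending edge.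
\<close>

inductive spiked_walk :: "'a \<Rightarrow> 'b signed_edge list \<Rightarrow> bool" where
  spiked_Nil: "u \<in> verts G \<Longrightarrow> spiked_walk u []"
| spiked_plain: "e \<in> arcs G \<Longrightarrow> spiked_walk (head G e) t \<Longrightarrow> spiked_walk (tail G e) (Minus e # t)"
| spiked_spike: "e \<in> arcs G \<Longrightarrow> spiked_walk (head G e) t \<Longrightarrow>
    spiked_walk (tail G e) (Minus e # Plus e # Minus e # t)"

lemma spiked_walk_run: "spiked_walk u t \<Longrightarrow> run G t (u, s) \<noteq> None"
  by (induction u t arbitrary: s rule: spiked_walk.induct) auto

lemma spiked_walk_letters: "spiked_walk u t \<Longrightarrow> set t \<subseteq> signed_edges G"
  by (induction u t rule: spiked_walk.induct) (auto simp: signed_edges_def)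

lemma spiked_walk_not_Plus: "\<not> spiked_walk u (Plus e # t)"
  by (auto elim: spiked_walk.cases)

lemma spiked_walks_gen_fun_ge:
  assumes u: "u \<in> verts G" and x: "0 \<le> x" and conv: "gf_conv (Collect (spiked_walk u)) x"
  shows "1 + (x + x ^ 3) * (\<Sum>e\<in>out_arcs G u. gen_fun (Collect (spiked_walk (head G e))) x)
    \<le> gen_fun (Collect (spiked_walk u)) x"
proof -
  define I where "I = out_arcs G u \<times> (UNIV :: bool set)"
  define T where "T p = Collect (spiked_walk (head G (fst p)))" for p :: "'b \<times> bool"
  define h where "h = (\<lambda>((e :: 'b, k), t). if k then Minus e # Plus e # Minus e # t else Minus e # t)"
  define f where "f k = (if k then x ^ 3 else x)" for k :: bool
  have inj: "inj_on h (Sigma I T)"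
    by (rule inj_onI) (auto simp: h_def T_def spiked_walk_not_Plus split: if_splits)
  have sub: "insert [] (h ` Sigma I T) \<subseteq> Collect (spiked_walk u)"
    using u by (auto simp: h_def I_def T_def intro: spiked_walk.intros)
  have conv': "gf_conv (h ` Sigma I T) x"
    by (rule gf_conv_subset[OF conv]) (use sub in blast)
  have "1 + gen_fun (h ` Sigma I T) x = gen_fun (insert [] (h ` Sigma I T)) x"
    using conv' by (subst gen_fun_insert_Nil) (auto simp: h_def split: if_splits)
  also have "\<dots> \<le> gen_fun (Collect (spiked_walk u)) x"
    unfolding gen_fun_def using sub x conv
    by (intro infsum_mono2 gf_conv_subset[OF conv sub]) auto
  finally have "1 + gen_fun (h ` Sigma I T) x \<le> gen_fun (Collect (spiked_walk u)) x" .
  moreover have "gen_fun (h ` Sigma I T) x =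
      (x + x ^ 3) * (\<Sum>e\<in>out_arcs G u. gen_fun (Collect (spiked_walk (head G e))) x)"
  proof -
    have "finite I" by (auto simp: I_def)
    then have "gen_fun (h ` Sigma I T) x = (\<Sum>p\<in>I. f (snd p) * gen_fun (T p) x)"
      by (rule gen_fun_image_Sigma[OF inj _ _ conv'])
        (auto simp: h_def f_def power3_eq_cube split: prod.split)
    also have "\<dots> = (\<Sum>e\<in>out_arcs G u. \<Sum>k\<in>(UNIV :: bool set). f k * gen_fun (T (e, k)) x)"
      unfolding I_def by (subst sum.cartesian_product) (auto intro: sum.cong)
    also have "\<dots> = (\<Sum>e\<in>out_arcs G u. (x + x ^ 3) * gen_fun (Collect (spiked_walk (head G e))) x)"
      by (intro sum.cong) (auto simp: UNIV_bool f_def T_def algebra_simps)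
    finally show ?thesis by (simp add: sum_distrib_left)
  qed
  ultimately show ?thesis by simp
qed

text \<open>
  Let $S_u$ be the generating function of the spiked walks from $u$, and suppose that all $S_u$
  are finite. For the largest $c$ with $S \ge cy$ there is a vertex $u$ with $y_u > 0$ and
  $S_u = cy_u$. There $S \ge 1 + (x+x^3)A_GS \ge 1 + (x+x^3)\kappa\,cy \ge 1 + cy$ gives a contradiction.
\<close>

lemma entropy_ge_by_spikes:
  assumes x: "0 < x" and k: "1 \<le> (x + x ^ 3) * \<kappa>"
    and y: "\<And>u. u \<in> verts G \<Longrightarrow> 0 \<le> y u" "\<exists>u\<in>verts G. y u \<noteq> 0"
    and sub: "\<And>u. u \<in> verts G \<Longrightarrow> \<kappa> * y u \<le> (\<Sum>e\<in>out_arcs G u. y (head G e))"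
    and ne: "arcs G \<noteq> {}"
  shows "- ln x \<le> topological_entropy (markov_dyck_shift G)"
proof (rule markov_dyck_entropy_ge[OF ne _ x])
  let ?W = "\<Union>u\<in>verts G. Collect (spiked_walk u)"
  show "runnable G w \<and> set w \<subseteq> signed_edges G" if "w \<in> ?W" for w
    using that spiked_walk_run[of _ w "[]"] spiked_walk_letters[of _ w]
    unfolding runnable_def by blast
  show "\<not> gf_conv ?W x"
  proof
    assume conv_W: "gf_conv ?W x"
    define S where "S u = gen_fun (Collect (spiked_walk u)) x" for u
    have conv: "gf_conv (Collect (spiked_walk u)) x" if "u \<in> verts G" for u
      by (rule gf_conv_subset[OF conv_W]) (use that in auto)
    have S_ge: "1 + (x + x ^ 3) * (\<Sum>e\<in>out_arcs G u. S (head G e)) \<le> S u" if "u \<in> verts G" for u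
      unfolding S_def using that x conv by (intro spiked_walks_gen_fun_ge) auto
    define P where "P = {u \<in> verts G. 0 < y u}"
    have P: "finite P" "P \<noteq> {}"
      using y by (auto simp: P_def less_le)
    define c where "c = Min ((\<lambda>u. S u / y u) ` P)"
    have "c \<in> (\<lambda>u. S u / y u) ` P"
      unfolding c_def using P by (intro Min_in) auto
    then obtain u where u: "u \<in> P" "c = S u / y u" by auto
    have S_nonneg: "0 \<le> S w" for w
      unfolding S_def using x by (intro gen_fun_nonneg) auto
    have le: "c * y w \<le> S w" if "w \<in> verts G" for w
    proof (cases "w \<in> P")
      case True
      then have "c \<le> S w / y w"
        unfolding c_def using P by (intro Min_le) auto
      with True show ?thesis by (simp add: P_def field_simps)
    next
      case False
      with that y(1)[OF that] have "y w = 0" by (auto simp: P_def)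
      with S_nonneg show ?thesis by simp
    qed
    have uG: "u \<in> verts G" "0 < y u" using u by (auto simp: P_def)
    have c: "0 \<le> c" using u uG S_nonneg by simp
    have pos: "0 < x + x ^ 3" using x by (simp add: add_pos_pos)
    have "S u = c * y u" using u uG by simp
    also have "\<dots> \<le> ((x + x ^ 3) * \<kappa>) * (c * y u)"
      using mult_right_mono[OF k, of "c * y u"] c uG by simp
    also have "\<dots> = ((x + x ^ 3) * c) * (\<kappa> * y u)" by simp
    also have "\<dots> \<le> ((x + x ^ 3) * c) * (\<Sum>e\<in>out_arcs G u. y (head G e))"
      using sub[OF uG(1)] pos c by (intro mult_left_mono) auto
    also have "\<dots> = (x + x ^ 3) * (\<Sum>e\<in>out_arcs G u. c * y (head G e))"
      by (simp add: sum_distrib_left mult.assoc)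
    also have "\<dots> \<le> (x + x ^ 3) * (\<Sum>e\<in>out_arcs G u. S (head G e))"
      using pos le by (intro mult_left_mono sum_mono) auto
    also have "\<dots> < S u" using S_ge[OF uG(1)] by simp
    finally show False by simp
  qed
qed

end


section \<open>Determinants and generating functions of walks\<close>

lemma eigenvalue_smult_iff:
  fixes A :: "'a :: field mat"
  assumes A: "A \<in> carrier_mat n n" and z: "z \<noteq> 0"
  shows "eigenvalue (z \<cdot>\<^sub>m A) a \<longleftrightarrow> eigenvalue A (a / z)"
proof -
  have "char_matrix (z \<cdot>\<^sub>m A) a = z \<cdot>\<^sub>m char_matrix A (a / z)"
    using A z by (intro eq_matI) (auto simp: char_matrix_def field_simps)
  then show ?thesis
    using A z by (simp add: eigenvalue_det[of _ n] char_matrix_def)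
qed

lemma norm_eigenvalue_le_spectral_radius:
  fixes A :: "complex mat"
  assumes A: "A \<in> carrier_mat n n" and "eigenvalue A a"
  shows "norm a \<le> spectral_radius A"
  using assms by (intro spectral_radius_mem_max(2)[OF A eigenvalue_imp_nonzero_dim[OF A]])
    (auto simp: spectrum_def)

lemma spectral_radius_smult_less_1:
  fixes A :: "complex mat"
  assumes A: "A \<in> carrier_mat n n" and n: "0 < n" and z: "z \<noteq> 0" "norm z * spectral_radius A < 1"
  shows "spectral_radius (z \<cdot>\<^sub>m A) < 1"
proof -
  have zA: "z \<cdot>\<^sub>m A \<in> carrier_mat n n" using A by simp
  obtain a where a: "eigenvalue (z \<cdot>\<^sub>m A) a" "spectral_radius (z \<cdot>\<^sub>m A) = norm a"
    using spectral_radius_mem_max(1)[OF zA n] by (auto simp: spectrum_def)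
  have "norm (a / z) \<le> spectral_radius A"
    using a(1) by (intro norm_eigenvalue_le_spectral_radius[OF A]) (simp add: eigenvalue_smult_iff[OF A z(1)])
  then have "norm a \<le> norm z * spectral_radius A"
    using z(1) by (simp add: norm_divide field_simps)
  with a(2) z(2) show ?thesis by simp
qed

lemma smult_one_mat_mult_vec:
  fixes S :: "'a :: comm_ring_1 vec"
  assumes S: "S \<in> carrier_vec n"
  shows "(c \<cdot>\<^sub>m 1\<^sub>m n) *\<^sub>v S = c \<cdot>\<^sub>v S"
proof (rule eq_vecI)
  fix i assume "i < dim_vec (c \<cdot>\<^sub>v S)"
  then have i: "i < n" using S by simp
  then have "((c \<cdot>\<^sub>m 1\<^sub>m n) *\<^sub>v S) $ i = (\<Sum>j=0..<n. (c * (if j = i then 1 else 0)) * S $ j)"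
    using S by (simp add: scalar_prod_def)
  also have "\<dots> = (\<Sum>j=0..<n. if j = i then c * S $ j else 0)"
    by (intro sum.cong) auto
  finally show "((c \<cdot>\<^sub>m 1\<^sub>m n) *\<^sub>v S) $ i = (c \<cdot>\<^sub>v S) $ i"
    using i S by simp
qed (use S in simp)

lemma pow_mat_Suc_left:
  assumes M: "M \<in> carrier_mat n n"
  shows "M ^\<^sub>m Suc k = M * M ^\<^sub>m k"
proof (induction k)
  case (Suc k)
  have "M ^\<^sub>m Suc (Suc k) = (M * M ^\<^sub>m k) * M"
    by (simp only: pow_mat.simps(2)[of M "Suc k"] Suc.IH)
  also have "\<dots> = M * (M ^\<^sub>m k * M)"
    by (rule assoc_mult_mat[OF M pow_carrier_mat[OF M] M])
  finally show ?case by simp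
qed (use M in simp)

lemma det_affine_poly:
  "\<exists>P. \<forall>z :: real. Determinant.det (mat n n (\<lambda>ij. a ij + z * b ij)) = poly P z"
proof
  let ?P = "\<Sum>p\<in>{p. p permutes {0..<n}}. [:signof p:] * (\<Prod>i=0..<n. [:a (i, p i), b (i, p i):])"
  show "\<forall>z. Determinant.det (mat n n (\<lambda>ij. a ij + z * b ij)) = poly ?P z"
  proof
    fix z
    have "Determinant.det (mat n n (\<lambda>ij. a ij + z * b ij)) =
      (\<Sum>p\<in>{p. p permutes {0..<n}}. signof p * (\<Prod>i=0..<n. a (i, p i) + z * b (i, p i)))"
      by (subst det_def'[of _ n]) (auto intro!: sum.cong prod.cong simp: permutes_in_image)
    then show "Determinant.det (mat n n (\<lambda>ij. a ij + z * b ij)) = poly ?P z"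
      by (simp add: poly_sum poly_prod)
  qed
qed

context fin_digraph
begin

abbreviation "num_verts \<equiv> card (verts G)"
abbreviation "vl \<equiv> vertex_list G"
abbreviation "A\<^sub>G \<equiv> adjacency_matrix G"

lemma vertex_list: "distinct vl" "set vl = verts G" "length vl = num_verts"
proof -
  have "\<exists>vs. distinct vs \<and> set vs = verts G"
    using finite_distinct_list[OF finite_verts] by blast
  from someI_ex[OF this] show 1: "distinct vl" "set vl = verts G"
    by (auto simp: vertex_list_def)
  show "length vl = num_verts"
    using distinct_card[OF 1(1)] 1(2) by simp
qed

lemma vertex_index:
  assumes "v \<in> verts G"
  shows "vertex_index G v < num_verts" "vl ! vertex_index G v = v"
proof -
  have "\<exists>!i. i < length vl \<and> vl ! i = v"
    using assms vertex_list by (metis distinct_Ex1)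
  from theI'[OF this] show "vertex_index G v < num_verts" "vl ! vertex_index G v = v"
    by (simp_all add: vertex_index_def vertex_list)
qed

lemma vl_in_verts: "i < num_verts \<Longrightarrow> vl ! i \<in> verts G"
  using vertex_list by (metis nth_mem)

lemma adjacency_matrix_carrier [simp]: "A\<^sub>G \<in> carrier_mat num_verts num_verts"
  by (simp add: adjacency_matrix_def)

lemma adjacency_matrix_dim [simp]: "dim_row A\<^sub>G = num_verts" "dim_col A\<^sub>G = num_verts"
  by (simp_all add: adjacency_matrix_def)

lemma sum_out_arcs:
  fixes y :: "'a \<Rightarrow> real"
  assumes "i < num_verts"
  shows "(\<Sum>e\<in>out_arcs G (vl ! i). y (head G e)) = (\<Sum>j<num_verts. A\<^sub>G $$ (i, j) * y (vl ! j))"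
proof -
  have "(\<Sum>e\<in>out_arcs G (vl ! i). y (head G e)) =
      (\<Sum>w\<in>verts G. \<Sum>e\<in>{e \<in> out_arcs G (vl ! i). head G e = w}. y (head G e))"
    by (rule sum.group[symmetric]) auto
  also have "\<dots> = (\<Sum>w\<in>verts G. real (num_edges G (vl ! i) w) * y w)"
    by (auto simp: num_edges_def intro!: sum.cong arg_cong[of _ _ card])
  also have "\<dots> = (\<Sum>j<num_verts. real (num_edges G (vl ! i) (vl ! j)) * y (vl ! j))"
  proof (rule sum.reindex_bij_betw[symmetric])
    show "bij_betw ((!) vl) {..<num_verts} (verts G)"
      using bij_betw_nth[OF vertex_list(1)] vertex_list by simp
  qed
  also have "\<dots> = (\<Sum>j<num_verts. A\<^sub>G $$ (i, j) * y (vl ! j))"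
    using assms by (intro sum.cong) (auto simp: adjacency_matrix_def)
  finally show ?thesis .
qed

definition walks :: "'a \<Rightarrow> 'a \<Rightarrow> 'b list set" where
  "walks u w = {p. awalk u p w}"

definition walks_of_length :: "nat \<Rightarrow> 'a \<Rightarrow> 'a \<Rightarrow> 'b list set" where
  "walks_of_length k u w = {p. awalk u p w \<and> length p = k}"

lemma finite_walks_of_length: "finite (walks_of_length k u w)"
  by (rule finite_subset[OF _ finite_lists_length_eq[OF finite_arcs, of k]])
    (auto simp: walks_of_length_def awalk_def)

lemma card_walks_Suc:
  "card (walks_of_length (Suc k) u w) = (\<Sum>e\<in>out_arcs G u. card (walks_of_length k (head G e) w))"
proof -
  have "walks_of_length (Suc k) u w = (\<Union>e\<in>out_arcs G u. (#) e ` walks_of_length k (head G e) w)"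
    by (auto simp: walks_of_length_def awalk_Cons_iff length_Suc_conv image_iff)
  also have "card \<dots> = (\<Sum>e\<in>out_arcs G u. card ((#) e ` walks_of_length k (head G e) w))"
    by (rule card_UN_disjoint) (auto simp: finite_walks_of_length)
  also have "\<dots> = (\<Sum>e\<in>out_arcs G u. card (walks_of_length k (head G e) w))"
    by (intro sum.cong card_image) auto
  finally show ?thesis .
qed

lemma pow_adjacency_matrix:
  assumes "i < num_verts" "j < num_verts"
  shows "((z \<cdot>\<^sub>m A\<^sub>G) ^\<^sub>m k) $$ (i, j) = z ^ k * real (card (walks_of_length k (vl ! i) (vl ! j)))"
  using assms
proof (induction k arbitrary: i)
  case 0
  have "walks_of_length 0 (vl ! i) (vl ! j) = (if i = j then {[]} else {})"
    using 0 vl_in_verts[of i] vertex_list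
    by (auto simp: walks_of_length_def awalk_Nil_iff nth_eq_iff_index_eq)
  with 0 show ?case by simp
next
  case (Suc k)
  let ?M = "z \<cdot>\<^sub>m A\<^sub>G"
  have M: "?M \<in> carrier_mat num_verts num_verts" by simp
  have Mk: "?M ^\<^sub>m k \<in> carrier_mat num_verts num_verts"
    by (simp add: pow_carrier_mat)
  have "?M ^\<^sub>m Suc k = ?M * ?M ^\<^sub>m k"
    by (rule pow_mat_Suc_left[OF M])
  then have "(?M ^\<^sub>m Suc k) $$ (i, j) = (\<Sum>l<num_verts. z * A\<^sub>G $$ (i, l) * (?M ^\<^sub>m k) $$ (l, j))"
    using Suc.prems Mk by (simp add: scalar_prod_def lessThan_atLeast0)
  also have "\<dots> = (\<Sum>l<num_verts. A\<^sub>G $$ (i, l) * (z ^ Suc k * real (card (walks_of_length k (vl ! l) (vl ! j)))))"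
    using Suc by (intro sum.cong) (auto simp: mult_ac)
  also have "\<dots> = (\<Sum>e\<in>out_arcs G (vl ! i). z ^ Suc k * real (card (walks_of_length k (head G e) (vl ! j))))"
    using Suc.prems by (subst sum_out_arcs[symmetric]) auto
  also have "\<dots> = z ^ Suc k * real (card (walks_of_length (Suc k) (vl ! i) (vl ! j)))"
    by (simp add: card_walks_Suc sum_distrib_left)
  finally show ?case .
qed

text \<open>
  For $y < 1/\kappa$ the spectral radius of $yA_G$ is less than $1$, so the powers of $yA_G$, whose
  entries are $y^k$ times numbers of walks, are bounded. For $z < y$ this gives a geometric majorant.
\<close>

lemma walks_converge:
  assumes \<kappa>: "spectral_radius (map_mat complex_of_real A\<^sub>G) \<le> \<kappa>" "0 < \<kappa>"
    and z: "0 \<le> z" "z * \<kappa> < 1" and uw: "u \<in> verts G" "w \<in> verts G"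
  shows "gf_conv (walks u w) z"
proof -
  define i j where "i = vertex_index G u" "j = vertex_index G w"
  have ij: "i < num_verts" "j < num_verts" "vl ! i = u" "vl ! j = w"
    using uw vertex_index by (auto simp: i_j_def)
  obtain y where y: "z < y" "y < 1 / \<kappa>"
    using dense[of z "1 / \<kappa>"] z \<kappa> by (auto simp: field_simps)
  have y0: "0 < y" using y z by simp
  let ?C = "map_mat complex_of_real A\<^sub>G"
  have "y * spectral_radius ?C \<le> y * \<kappa>" using y0 \<kappa> by simp
  also have "y * \<kappa> < 1" using y \<kappa> by (simp add: field_simps)
  finally have "spectral_radius (complex_of_real y \<cdot>\<^sub>m ?C) < 1"
    using ij y0 by (intro spectral_radius_smult_less_1[of _ num_verts]) auto
  from spectral_radius_jnf_norm_bound_less_1_upper_triangular[OF _ this, of num_verts]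
  obtain c where c: "\<And>k. norm_bound ((complex_of_real y \<cdot>\<^sub>m ?C) ^\<^sub>m k) c"
    by auto
  have "complex_of_real y \<cdot>\<^sub>m ?C = map_mat complex_of_real (y \<cdot>\<^sub>m A\<^sub>G)"
    by (intro eq_matI) auto
  then have eq: "(complex_of_real y \<cdot>\<^sub>m ?C) ^\<^sub>m k = map_mat complex_of_real ((y \<cdot>\<^sub>m A\<^sub>G) ^\<^sub>m k)" for k
    by (simp add: of_real_hom.mat_hom_pow[of _ num_verts])
  have bound: "y ^ k * real (card (walks_of_length k u w)) \<le> c" for k
  proof -
    have dim: "dim_row ((y \<cdot>\<^sub>m A\<^sub>G) ^\<^sub>m k) = num_verts" "dim_col ((y \<cdot>\<^sub>m A\<^sub>G) ^\<^sub>m k) = num_verts"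
      using pow_carrier_mat[of "y \<cdot>\<^sub>m A\<^sub>G" num_verts k] by auto
    have "norm (complex_of_real (((y \<cdot>\<^sub>m A\<^sub>G) ^\<^sub>m k) $$ (i, j))) \<le> c"
      using c[of k] ij dim unfolding norm_bound_def eq by auto
    then show ?thesis
      using y0 unfolding norm_of_real by (simp add: pow_adjacency_matrix[OF ij(1,2)] ij)
  qed
  have summ: "summable (\<lambda>k. real (card (walks_of_length k u w)) * z ^ k)"
  proof (rule summable_comparison_test')
    show "summable (\<lambda>k. c * (z / y) ^ k)"
      using z y by (intro summable_mult summable_geometric) auto
    show "norm (real (card (walks_of_length k u w)) * z ^ k) \<le> c * (z / y) ^ k" for k
    proof -
      have "real (card (walks_of_length k u w)) * z ^ k =
          (y ^ k * real (card (walks_of_length k u w))) * (z / y) ^ k"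
        using y0 by (simp add: power_divide)
      also have "\<dots> \<le> c * (z / y) ^ k"
        using bound[of k] z y0 by (intro mult_right_mono) auto
      finally show ?thesis using z by simp
    qed
  qed
  have "gf_conv (\<Union>k. walks_of_length k u w) z"
    by (rule gf_conv_of_counts[OF finite_walks_of_length _ z(1) summ])
      (simp add: walks_of_length_def)
  moreover have "(\<Union>k. walks_of_length k u w) = walks u w"
    by (auto simp: walks_of_length_def walks_def)
  ultimately show ?thesis by simp
qed

lemma walks_gen_fun:
  assumes "u \<in> verts G" "gf_conv (walks u v) z"
  shows "gen_fun (walks u v) z =
    (if u = v then 1 else 0) + z * (\<Sum>e\<in>out_arcs G u. gen_fun (walks (head G e) v) z)"
proof -
  let ?h = "\<lambda>(e, p). e # p" and ?P = "SIGMA e:out_arcs G u. walks (head G e) v"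
  have eq: "walks u v = (if u = v then insert [] (?h ` ?P) else ?h ` ?P)"
  proof (rule Set.set_eqI)
    fix p
    show "p \<in> walks u v \<longleftrightarrow> p \<in> (if u = v then insert [] (?h ` ?P) else ?h ` ?P)"
      using assms(1) by (cases p) (auto simp: walks_def awalk_simps image_iff)
  qed
  have conv: "gf_conv (?h ` ?P) z"
    by (rule gf_conv_subset[OF assms(2)]) (subst eq, auto)
  have "gen_fun (walks u v) z = (if u = v then 1 else 0) + gen_fun (?h ` ?P) z"
  proof (cases "u = v")
    case True
    have "[] \<notin> ?h ` ?P" by auto
    from gen_fun_insert_Nil[OF conv this] show ?thesis
      by (subst eq) (simp only: True HOL.refl if_True)
  next
    case False
    then show ?thesis by (subst eq) simp
  qed
  also have "gen_fun (?h ` ?P) z = (\<Sum>e\<in>out_arcs G u. z * gen_fun (walks (head G e) v) z)"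
    using conv by (intro gen_fun_image_Sigma) (auto simp: inj_on_def)
  finally show ?thesis by (simp add: sum_distrib_left)
qed

text \<open>
  The vector $S$ of the generating functions of the walks ending in $v$ solves
  $(I - A_G z) S = \delta_v$. Multiplying by the adjugate of $I - A_G z$ and comparing the entries
  at $v$ gives $p_v(z) = p(z) S_v$.
\<close>

lemma p_minor_eq_p_det_loops:
  assumes v: "v \<in> verts G" and conv: "\<And>u. u \<in> verts G \<Longrightarrow> gf_conv (walks u v) z"
  shows "p_minor G v z = p_det G z * gen_fun (loops v) z"
proof -
  let ?n = "num_verts" and ?B = "I_minus_Az G z"
  define r where "r = vertex_index G v"
  have r: "r < ?n" "vl ! r = v" using vertex_index[OF v] by (auto simp: r_def)
  define S where "S = vec ?n (\<lambda>i. gen_fun (walks (vl ! i) v) z)"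
  have S: "S \<in> carrier_vec ?n" by (simp add: S_def)
  have B: "?B \<in> carrier_mat ?n ?n" by (rule carrier_matI) (simp_all add: I_minus_Az_def)
  have BS: "?B *\<^sub>v S = unit_vec ?n r"
  proof (rule eq_vecI)
    fix i assume "i < dim_vec (unit_vec ?n r)"
    then have i: "i < ?n" by simp
    have "(?B *\<^sub>v S) $ i = (\<Sum>j<?n. ((if i = j then 1 else 0) - z * A\<^sub>G $$ (i, j)) * S $ j)"
      using i B S by (simp add: scalar_prod_def lessThan_atLeast0 I_minus_Az_def)
    also have "\<dots> = (\<Sum>j<?n. if i = j then S $ j else 0) - z * (\<Sum>j<?n. A\<^sub>G $$ (i, j) * S $ j)"
      unfolding sum_distrib_left sum_subtractf[symmetric] by (intro sum.cong) (auto simp: algebra_simps)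
    also have "(\<Sum>j<?n. A\<^sub>G $$ (i, j) * S $ j) = (\<Sum>e\<in>out_arcs G (vl ! i). gen_fun (walks (head G e) v) z)"
      using i by (subst sum_out_arcs[where y = "\<lambda>u. gen_fun (walks u v) z"]) (auto simp: S_def)
    also have "(\<Sum>j<?n. if i = j then S $ j else 0) = S $ i"
      using i by simp
    also have "S $ i = (if vl ! i = v then 1 else 0) +
        z * (\<Sum>e\<in>out_arcs G (vl ! i). gen_fun (walks (head G e) v) z)"
      using i conv vl_in_verts[OF i] walks_gen_fun[of "vl ! i" z v] by (simp add: S_def)
    also have "\<dots> - z * (\<Sum>e\<in>out_arcs G (vl ! i). gen_fun (walks (head G e) v) z) = unit_vec ?n r $ i"
      using i r vertex_list by (auto simp: nth_eq_iff_index_eq)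
    finally show "(?B *\<^sub>v S) $ i = unit_vec ?n r $ i" .
  qed (use B in auto)
  note adj = adj_mat[OF B]
  have "adj_mat ?B *\<^sub>v unit_vec ?n r = (adj_mat ?B * ?B) *\<^sub>v S"
    unfolding BS[symmetric] by (rule assoc_mult_mat_vec[symmetric, OF adj(1) B S])
  also have "\<dots> = p_det G z \<cdot>\<^sub>v S"
    unfolding adj(3) p_det_def by (rule smult_one_mat_mult_vec[OF S])
  finally have "(adj_mat ?B *\<^sub>v unit_vec ?n r) $ r = p_det G z * S $ r"
    using r S by simp
  moreover have "(adj_mat ?B *\<^sub>v unit_vec ?n r) $ r = adj_mat ?B $$ (r, r)"
    using r adj(1) by simp
  moreover have "adj_mat ?B $$ (r, r) = p_minor G v z"
    using r B by (simp add: adj_mat_def cofactor_def p_minor_def r_def[symmetric])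
  moreover have "S $ r = gen_fun (loops v) z"
    using r by (simp add: S_def walks_def loops_def)
  ultimately show ?thesis by simp
qed

lemma p_det_eq_0_iff:
  assumes "z \<noteq> 0"
  shows "p_det G z = 0 \<longleftrightarrow> eigenvalue A\<^sub>G (1 / z)"
proof -
  have "I_minus_Az G z = (-1) \<cdot>\<^sub>m char_matrix (z \<cdot>\<^sub>m A\<^sub>G) 1"
    by (intro eq_matI) (auto simp: I_minus_Az_def char_matrix_def)
  then have "p_det G z = 0 \<longleftrightarrow> eigenvalue (z \<cdot>\<^sub>m A\<^sub>G) 1"
    by (simp add: p_det_def eigenvalue_det[of _ num_verts])
  then show ?thesis
    using eigenvalue_smult_iff[of A\<^sub>G num_verts z 1] assms by simp
qed

lemma real_eigenvalue_le_spectral_radius: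
  assumes "eigenvalue A\<^sub>G a"
  shows "\<bar>a\<bar> \<le> spectral_radius (map_mat complex_of_real A\<^sub>G)"
proof -
  have "poly (char_poly (map_mat complex_of_real A\<^sub>G)) (complex_of_real a) = 0"
    using assms by (simp add: of_real_hom.char_poly_hom[of _ num_verts] eigenvalue_root_char_poly[of _ num_verts])
  then have "eigenvalue (map_mat complex_of_real A\<^sub>G) (complex_of_real a)"
    by (subst eigenvalue_root_char_poly[of _ num_verts]) auto
  from norm_eigenvalue_le_spectral_radius[OF _ this, of num_verts] show ?thesis by simp
qed

lemma p_det_polynomial: "\<exists>P. \<forall>z. p_det G z = poly P z"
proof -
  have "I_minus_Az G z = mat num_verts num_verts
      (\<lambda>ij. (if fst ij = snd ij then 1 else 0) + z * - A\<^sub>G $$ ij)" for z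
    by (intro eq_matI) (auto simp: I_minus_Az_def)
  then show ?thesis
    unfolding p_det_def by (simp only:) (rule det_affine_poly)
qed

lemma p_minor_polynomial: "\<exists>P. \<forall>z. p_minor G v z = poly P z"
proof -
  define r where "r = vertex_index G v"
  define sh where "sh i = (if i < r then i else Suc i)" for i
  have "mat_delete (I_minus_Az G z) r r = mat (num_verts - 1) (num_verts - 1)
      (\<lambda>ij. (if fst ij = snd ij then 1 else 0) + z * - A\<^sub>G $$ (sh (fst ij), sh (snd ij)))" for z
    by (intro eq_matI) (auto simp: mat_delete_def I_minus_Az_def sh_def)
  then show ?thesis
    unfolding p_minor_def r_def[symmetric] by (simp only:) (rule det_affine_poly)
qed

end


section \<open>Convexity estimates\<close>

text \<open>
  Jensen's inequality for the exponential function and the weights $w$, whose mean of $l$ is only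
  assumed to be at most $M$. It follows by summing the tangent inequality at $M$.
\<close>

lemma exp_moment_ge:
  fixes w l :: "'a \<Rightarrow> real"
  assumes w: "\<And>a. a \<in> A \<Longrightarrow> 0 \<le> w a"
    and summ: "w summable_on A" "(\<lambda>a. w a * l a) summable_on A" "(\<lambda>a. w a * exp (- (t * l a))) summable_on A"
    and mean: "(\<Sum>\<^sub>\<infinity>a\<in>A. w a * l a) \<le> M * infsum w A" and t: "0 \<le> t"
  shows "exp (- (t * M)) * infsum w A \<le> (\<Sum>\<^sub>\<infinity>a\<in>A. w a * exp (- (t * l a)))"
proof -
  define E where "E = exp (- (t * M))"
  have tangent: "w a * (E * (1 + t * M)) + - (E * t) * (w a * l a) \<le> w a * exp (- (t * l a))"
    if "a \<in> A" for a
  proof -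
    have "1 + (t * M - t * l a) \<le> exp (t * M - t * l a)"
      by (rule exp_ge_add_one_self)
    then have "E * (1 + (t * M - t * l a)) \<le> E * exp (t * M - t * l a)"
      by (intro mult_left_mono) (auto simp: E_def)
    also have "\<dots> = exp (- (t * l a))"
      by (simp add: E_def exp_add[symmetric])
    finally have "w a * (E * (1 + (t * M - t * l a))) \<le> w a * exp (- (t * l a))"
      using w[OF that] by (intro mult_left_mono)
    then show ?thesis by (simp add: algebra_simps)
  qed
  have s1: "(\<lambda>a. w a * (E * (1 + t * M))) summable_on A"
    by (rule summable_on_cmult_left[OF summ(1)])
  have s2: "(\<lambda>a. - (E * t) * (w a * l a)) summable_on A"
    by (rule summable_on_cmult_right[OF summ(2)])
  have "E * infsum w A \<le> E * infsum w A + E * t * (M * infsum w A - (\<Sum>\<^sub>\<infinity>a\<in>A. w a * l a))"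
    using mean t by (simp add: E_def)
  also have "\<dots> = infsum w A * (E * (1 + t * M)) + - (E * t) * (\<Sum>\<^sub>\<infinity>a\<in>A. w a * l a)"
    by (simp add: algebra_simps)
  also have "\<dots> = (\<Sum>\<^sub>\<infinity>a\<in>A. w a * (E * (1 + t * M)) + - (E * t) * (w a * l a))"
    by (simp only: infsum_add[OF s1 s2] infsum_cmult_left' infsum_cmult_right')
  also have "\<dots> \<le> (\<Sum>\<^sub>\<infinity>a\<in>A. w a * exp (- (t * l a)))"
    by (intro infsum_mono summable_on_add s1 s2 summ(3) tangent)
  finally show ?thesis by (simp add: E_def)
qed

text \<open>
  If $B < E$, then with $b = B/E$ the equation gives $1 + ub^2 \le bE \le b(1+u)$, that is $(1-b)(1-ub) \le 0$,
  which is impossible for $0 < b < 1$.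
\<close>

lemma quadratic_root_ge:
  fixes u w E B :: real
  assumes u: "0 \<le> u" "u < 1" and E: "1 \<le> E" "E \<le> 1 + u" and w: "u / E\<^sup>2 \<le> w"
    and B: "1 \<le> B" "B = 1 + w * B\<^sup>2"
  shows "E \<le> B"
proof (rule ccontr)
  assume "\<not> E \<le> B"
  define b where "b = B / E"
  have b: "0 < b" "b < 1" "B = b * E"
    using B E \<open>\<not> E \<le> B\<close> by (auto simp: b_def)
  have "1 + u * b\<^sup>2 = 1 + u / E\<^sup>2 * B\<^sup>2"
    using E by (simp add: b(3) power_mult_distrib)
  also have "\<dots> \<le> 1 + w * B\<^sup>2"
    using w by (intro add_left_mono mult_right_mono) auto
  also have "\<dots> = b * E" using B(2) b(3) by simp
  also have "\<dots> \<le> b * (1 + u)"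
    using E b by (intro mult_left_mono) auto
  finally have "(1 - b) * (1 - u * b) \<le> 0"
    by (simp add: algebra_simps power2_eq_square)
  moreover have "u * b < 1"
    using u b by (metis less_eq_real_def mult_le_one order_le_less_trans mult_left_le)
  ultimately show False
    using b by (simp add: mult_le_0_iff)
qed

text \<open>
  Since $u = (1/2-s)(1/2+s)$ and $\log(1+u) \ge u/(1+u)$, the claim for $\rho = u$ reduces to
  $s(1+u) < (1/2+s)(u+s)$, and the difference of the two sides is $(s-1/2)^2/2$.
  The left-hand side of the claim decreases in $\rho$.
\<close>

lemma entropy_gain_bound:
  fixes u \<rho> s :: real
  assumes u: "0 < u" "u \<le> \<rho>" and s: "0 < s" "s\<^sup>2 = 1 / 4 - u"
  shows "s * (1 / 2 - s) / (\<rho> + s) < ln (1 + u)"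
proof -
  have "s\<^sup>2 < (1 / 2)\<^sup>2" using s u by (simp add: power2_eq_square)
  then have s2: "s < 1 / 2" by (rule power_less_imp_less_base) simp
  have u_eq: "u = (1 / 2 - s) * (1 / 2 + s)"
    using s(2) by (simp add: algebra_simps power2_eq_square)
  have "s * (1 / 2 - s) / (\<rho> + s) \<le> s * (1 / 2 - s) / (u + s)"
    using u s s2 by (intro divide_left_mono) auto
  also have "\<dots> < u / (1 + u)"
  proof -
    have "0 < (s - 1 / 2)\<^sup>2" using s2 by simp
    moreover have "(1 / 2 + s) * (u + s) - s * (1 + u) = (s - 1 / 2)\<^sup>2 / 2"
      unfolding u_eq by (simp add: field_simps power2_eq_square)
    ultimately have "s * (1 + u) < (1 / 2 + s) * (u + s)" by linarith
    then have "(1 / 2 - s) * (s * (1 + u)) < (1 / 2 - s) * ((1 / 2 + s) * (u + s))"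
      using s2 by (intro mult_strict_left_mono) auto
    moreover have "(1 / 2 - s) * ((1 / 2 + s) * (u + s)) = u * (u + s)"
      by (simp only: u_eq mult.assoc)
    moreover have "(1 / 2 - s) * (s * (1 + u)) = s * (1 / 2 - s) * (1 + u)"
      by (simp only: mult_ac)
    ultimately have "s * (1 / 2 - s) * (1 + u) < u * (u + s)" by linarith
    then show ?thesis using u s by (simp add: divide_less_eq less_divide_eq mult_ac)
  qed
  also have "\<dots> \<le> ln (1 + u)"
  proof -
    have "- ln (1 + u) \<le> 1 / (1 + u) - 1"
      using ln_le_minus_one[of "1 / (1 + u)"] u by (simp add: ln_div)
    also have "\<dots> = - (u / (1 + u))" using u by (simp add: field_simps)
    finally show ?thesis by simp
  qed
  finally show ?thesis .
qed


section \<open>First returns at the inverse Perron eigenvalue\<close>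

locale perron_digraph = fin_digraph G for G :: "('a, 'b) pre_digraph" +
  fixes \<kappa> \<rho> :: real
  assumes perron: "perron_eigenvalue (adjacency_matrix G) \<kappa>"
    and \<kappa>_pos: "0 < \<kappa>" and \<rho>_def: "\<rho> = 1 / \<kappa>"
begin

abbreviation "F v \<equiv> gen_fun (first_returns v)"

lemma \<rho>_pos: "0 < \<rho>"
  using \<kappa>_pos by (simp add: \<rho>_def)

lemma walks_conv: "v \<in> verts G \<Longrightarrow> u \<in> verts G \<Longrightarrow> 0 \<le> z \<Longrightarrow> z < \<rho> \<Longrightarrow> gf_conv (walks u v) z"
  using perron \<kappa>_pos by (intro walks_converge[of \<kappa>]) (auto simp: perron_eigenvalue_def \<rho>_def field_simps)

lemma loops_eq_walks: "loops v = walks v v"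
  by (simp add: loops_def walks_def)

lemma first_returns_below:
  assumes "v \<in> verts G" "0 \<le> z" "z < \<rho>"
  shows "gf_conv (first_returns v) z" "F v z < 1"
    and "F v z = 1 - 1 / gen_fun (loops v) z"
  using assms walks_conv[of v v z] first_returns_gen_fun[of v z] first_returns_loops[of v]
  by (auto simp: loops_eq_walks intro: gf_conv_subset)

lemma p_det_at_\<rho>: "p_det G \<rho> = 0"
proof -
  have "eigenvalue A\<^sub>G \<kappa>"
    using perron unfolding perron_eigenvalue_def by blast
  moreover have "1 / \<rho> = \<kappa>" by (simp add: \<rho>_def)
  ultimately show ?thesis
    using p_det_eq_0_iff[of \<rho>] \<rho>_pos by simp
qed

lemma p_det_below_\<rho>:
  assumes "0 < z" "z < \<rho>"
  shows "p_det G z \<noteq> 0"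
proof
  assume "p_det G z = 0"
  then have "eigenvalue A\<^sub>G (1 / z)"
    using assms(1) by (simp add: p_det_eq_0_iff)
  then have "\<bar>1 / z\<bar> \<le> \<kappa>"
    using perron real_eigenvalue_le_spectral_radius unfolding perron_eigenvalue_def by metis
  with assms \<kappa>_pos show False by (simp add: \<rho>_def field_simps)
qed

lemma q_ratio_below_\<rho>:
  assumes v: "v \<in> verts G" and z: "0 < z" "z < \<rho>"
  shows "q_ratio G v z = 1 - F v z"
proof -
  have "p_minor G v z = p_det G z * gen_fun (loops v) z"
    using assms walks_conv by (intro p_minor_eq_p_det_loops) auto
  then show ?thesis
    using p_det_below_\<rho>[OF z] first_returns_below(3)[of v z] assms by (simp add: q_ratio_def)
qed

lemma eventually_at_left_\<rho>: "eventually (\<lambda>z. 0 < z \<and> z < \<rho>) (at_left \<rho>)"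
  using eventually_at_left_field[of "\<lambda>z. 0 < z \<and> z < \<rho>" \<rho>] \<rho>_pos by blast

text \<open>
  The finite partial sums of $F(\rho)$ are limits of partial sums of $F(z) < 1$ as $z$ increases
  to $\rho$.
\<close>

lemma first_returns_at_\<rho>:
  assumes v: "v \<in> verts G"
  shows "gf_conv (first_returns v) \<rho>" "F v \<rho> \<le> 1"
proof -
  have fin: "(\<Sum>a\<in>S. \<rho> ^ length a) \<le> 1" if S: "finite S" "S \<subseteq> first_returns v" for S
  proof (rule tendsto_upperbound)
    show "((\<lambda>z. \<Sum>a\<in>S. z ^ length a) \<longlongrightarrow> (\<Sum>a\<in>S. \<rho> ^ length a)) (at_left \<rho>)"
      by (intro tendsto_intros)
    show "eventually (\<lambda>z. (\<Sum>a\<in>S. z ^ length a) \<le> 1) (at_left \<rho>)"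
      using eventually_at_left_\<rho>
    proof eventually_elim
      case (elim z)
      have "(\<Sum>a\<in>S. z ^ length a) \<le> F v z"
        using elim S first_returns_below[OF v] by (intro gen_fun_ge_finite) auto
      with first_returns_below(2)[OF v, of z] elim show ?case by simp
    qed
  qed simp
  show conv: "gf_conv (first_returns v) \<rho>"
    using \<rho>_pos fin by (intro nonneg_bdd_above_summable_on) (auto intro!: bdd_aboveI2[where M = 1])
  show "F v \<rho> \<le> 1"
    unfolding gen_fun_def using fin by (intro infsum_le_finite_sums conv)
qed

text \<open>First returns are nonempty, hence $\rho^{2|a|} \le \rho\cdot\rho^{|a|}$.\<close>

lemma first_returns_at_\<rho>_square:
  assumes v: "v \<in> verts G" and "\<rho> < 1"
  shows "F v (\<rho>\<^sup>2) \<le> \<rho>"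
proof -
  have "\<rho>\<^sup>2 \<le> \<rho>" using \<rho>_pos \<open>\<rho> < 1\<close> by (simp add: power2_eq_square mult_left_le)
  have "F v (\<rho>\<^sup>2) \<le> (\<Sum>\<^sub>\<infinity>a\<in>first_returns v. \<rho> * \<rho> ^ length a)"
    unfolding gen_fun_def
  proof (rule infsum_mono)
    show "gf_conv (first_returns v) (\<rho>\<^sup>2)"
      using \<open>\<rho>\<^sup>2 \<le> \<rho>\<close> by (intro gf_conv_mono[OF first_returns_at_\<rho>(1)[OF v]]) auto
    show "(\<lambda>a. \<rho> * \<rho> ^ length a) summable_on first_returns v"
      by (rule summable_on_cmult_right[OF first_returns_at_\<rho>(1)[OF v]])
    fix a assume "a \<in> first_returns v"
    then have "1 \<le> length a" by (cases a) (auto simp: first_returns_def)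
    then have "\<rho> ^ length a \<le> \<rho> ^ 1"
      using \<rho>_pos \<open>\<rho> < 1\<close> by (intro power_decreasing) auto
    then show "(\<rho>\<^sup>2) ^ length a \<le> \<rho> * \<rho> ^ length a"
      using \<rho>_pos by (simp add: power2_eq_square power_mult_distrib mult_right_mono)
  qed
  also have "\<dots> = \<rho> * F v \<rho>"
    by (simp add: infsum_cmult_right' gen_fun_def)
  also have "\<dots> \<le> \<rho>"
    using first_returns_at_\<rho>(2)[OF v] \<rho>_pos by (simp add: mult_left_le)
  finally show ?thesis .
qed

lemma q_ratio_at_\<rho>_square:
  assumes "v \<in> verts G" and "\<rho> < 1"
  shows "q_ratio G v (\<rho>\<^sup>2) = 1 - F v (\<rho>\<^sup>2)"
  using assms \<rho>_pos by (intro q_ratio_below_\<rho>) (auto simp: power2_eq_square)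

lemma p_det_has_deriv: "(p_det G has_real_derivative deriv (p_det G) z) (at z)"
proof -
  obtain P where "p_det G = poly P" using p_det_polynomial by blast
  then show ?thesis using poly_DERIV DERIV_imp_deriv by metis
qed

text \<open>
  Here $q_v = p/p_v$ is differentiable at $\rho$ with $q_v(\rho) = 0$ and
  $q_v'(\rho) = p'(\rho)/p_v(\rho)$. To the left of $\rho$ it equals $1 - F$. So $F$ tends to $1$ there,
  and its difference quotients between $z < \rho$ and $\rho$ tend to $-q_v'(\rho) = M/\rho$. Those of
  a finite partial sum of $F$ are not larger, so its derivative at $\rho$ is at most $M/\rho$.
\<close>

lemma first_returns_recurrent:
  assumes v: "v \<in> verts G" and nz: "p_minor G v \<rho> \<noteq> 0"
  defines "M \<equiv> - (\<rho> * deriv (p_det G) \<rho>) / p_minor G v \<rho>"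
  shows "F v \<rho> = 1"
    and "(\<lambda>a. \<rho> ^ length a * real (length a)) summable_on first_returns v"
    and "(\<Sum>\<^sub>\<infinity>a\<in>first_returns v. \<rho> ^ length a * real (length a)) \<le> M"
proof -
  let ?R = "first_returns v"
  obtain P where P: "p_minor G v = poly P" using p_minor_polynomial by blast
  define q where "q = q_ratio G v"
  define D where "D = deriv (p_det G) \<rho> / p_minor G v \<rho>"
  have q_deriv: "(q has_real_derivative D) (at \<rho>)"
  proof -
    have "((\<lambda>z. p_det G z / p_minor G v z) has_real_derivative
        (deriv (p_det G) \<rho> * p_minor G v \<rho> - p_det G \<rho> * poly (pderiv P) \<rho>) / (p_minor G v \<rho> * p_minor G v \<rho>)) (at \<rho>)"
      using nz unfolding P by (intro DERIV_divide p_det_has_deriv poly_DERIV)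
    then show ?thesis
      using nz by (simp add: p_det_at_\<rho> q_def q_ratio_def[abs_def] D_def)
  qed
  have q\<rho>: "q \<rho> = 0" by (simp add: q_def q_ratio_def p_det_at_\<rho>)
  have qz: "q z = 1 - F v z" if "0 < z" "z < \<rho>" for z
    unfolding q_def by (rule q_ratio_below_\<rho>[OF v that])
  note conv = first_returns_at_\<rho>(1)[OF v]
  have "(q \<longlongrightarrow> q \<rho>) (at_left \<rho>)"
    using DERIV_isCont[OF q_deriv] by (auto simp: isCont_def intro: tendsto_mono[OF at_le])
  then have lim: "((\<lambda>z. 1 - q z) \<longlongrightarrow> 1 - q \<rho>) (at_left \<rho>)"
    by (intro tendsto_intros)
  have "1 - q \<rho> \<le> F v \<rho>"
  proof (rule tendsto_upperbound[OF lim])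
    show "eventually (\<lambda>z. 1 - q z \<le> F v \<rho>) (at_left \<rho>)"
      using eventually_at_left_\<rho>
      by eventually_elim (auto simp: qz intro!: gen_fun_mono[OF conv])
  qed simp
  then show F1: "F v \<rho> = 1"
    using first_returns_at_\<rho>(2)[OF v] q\<rho> by simp
  have fin: "(\<Sum>a\<in>S. \<rho> ^ length a * real (length a)) \<le> M" if S: "finite S" "S \<subseteq> ?R" for S
  proof -
    \<comment> \<open>Left of $\rho$ this is $1$ minus the sum over the first returns outside $S$, hence at least
      its value at $\rho$; so its derivative at $\rho$ is at most $0$.\<close>
    define \<phi> where "\<phi> z = q z + (\<Sum>a\<in>S. z ^ length a)" for z
    define D' where "D' = D + (\<Sum>a\<in>S. real (length a) * \<rho> ^ (length a - 1))"
    have \<phi>_deriv: "(\<phi> has_real_derivative D') (at \<rho>)"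
      unfolding \<phi>_def D'_def
      by (rule DERIV_add[OF q_deriv]) (auto intro!: derivative_eq_intros sum.cong)
    have split: "F v z = (\<Sum>a\<in>S. z ^ length a) + gen_fun (?R - S) z" if "gf_conv ?R z" for z
    proof -
      have "gen_fun (S \<union> (?R - S)) z = gen_fun S z + gen_fun (?R - S) z"
        unfolding gen_fun_def using S
        by (intro infsum_Un_disjoint gf_conv_subset[OF that]) auto
      moreover have "S \<union> (?R - S) = ?R" using S by auto
      ultimately show ?thesis using S by (simp add: gen_fun_def)
    qed
    have mono: "\<phi> \<rho> \<le> \<phi> z" if "0 < z" "z < \<rho>" for z
    proof -
      have "gen_fun (?R - S) z \<le> gen_fun (?R - S) \<rho>"
        using that by (intro gen_fun_mono gf_conv_subset[OF conv]) auto
      moreover have "gf_conv ?R z" using that by (intro first_returns_below[OF v]) auto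
      ultimately show ?thesis
        using split[OF conv] split[of z] F1 qz[OF that] q\<rho> by (simp add: \<phi>_def)
    qed
    have "D' \<le> 0"
    proof (rule ccontr)
      assume "\<not> D' \<le> 0"
      then obtain d where d: "d > 0" "\<And>h. h > 0 \<Longrightarrow> h < d \<Longrightarrow> \<phi> (\<rho> - h) < \<phi> \<rho>"
        using DERIV_pos_inc_left[OF \<phi>_deriv] by auto
      define h where "h = min d \<rho> / 2"
      have "h > 0" "h < d" "h < \<rho>" using d(1) \<rho>_pos by (auto simp: h_def min_def)
      with d(2)[of h] mono[of "\<rho> - h"] show False by simp
    qed
    then have "\<rho> * (\<Sum>a\<in>S. real (length a) * \<rho> ^ (length a - 1)) \<le> \<rho> * - D"
      using \<rho>_pos by (intro mult_left_mono) (auto simp: D'_def)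
    also have "\<rho> * - D = M" by (simp add: M_def D_def)
    also have "\<rho> * (\<Sum>a\<in>S. real (length a) * \<rho> ^ (length a - 1)) = (\<Sum>a\<in>S. \<rho> ^ length a * real (length a))"
      unfolding sum_distrib_left
    proof (rule sum.cong[OF HOL.refl])
      fix a assume "a \<in> S"
      then show "\<rho> * (real (length a) * \<rho> ^ (length a - 1)) = \<rho> ^ length a * real (length a)"
        by (cases a) auto
    qed
    finally show ?thesis .
  qed
  show summ: "(\<lambda>a. \<rho> ^ length a * real (length a)) summable_on ?R"
    using \<rho>_pos fin by (intro nonneg_bdd_above_summable_on) (auto intro!: bdd_aboveI2[where M = M])
  show "(\<Sum>\<^sub>\<infinity>a\<in>?R. \<rho> ^ length a * real (length a)) \<le> M"
    using fin by (intro infsum_le_finite_sums summ)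
qed


section \<open>Lower bounds for the entropy\<close>

text \<open>The absolute values of the entries of an eigenvector, by the triangle inequality.\<close>

lemma nonneg_subharmonic_vector:
  obtains y :: "'a \<Rightarrow> real" where
    "\<And>u. u \<in> verts G \<Longrightarrow> 0 \<le> y u" "\<exists>u\<in>verts G. y u \<noteq> 0"
    "\<And>u. u \<in> verts G \<Longrightarrow> \<kappa> * y u \<le> (\<Sum>e\<in>out_arcs G u. y (head G e))"
proof -
  let ?n = "num_verts"
  obtain x where x: "x \<in> carrier_vec ?n" "x \<noteq> 0\<^sub>v ?n" "A\<^sub>G *\<^sub>v x = \<kappa> \<cdot>\<^sub>v x"
    using perron by (auto simp: perron_eigenvalue_def eigenvalue_def eigenvector_def)
  define y where "y u = \<bar>x $ vertex_index G u\<bar>" for u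
  have idx: "vertex_index G (vl ! j) = j" if "j < ?n" for j
    using vertex_index[OF vl_in_verts[OF that]] that vertex_list by (metis nth_eq_iff_index_eq)
  show ?thesis
  proof (rule that)
    show "0 \<le> y u" for u by (simp add: y_def)
    obtain i where "i < ?n" "x $ i \<noteq> 0"
      using x(1,2) by (metis carrier_vecD eq_vecI index_zero_vec)
    then show "\<exists>u\<in>verts G. y u \<noteq> 0"
      using vl_in_verts[of i] by (auto simp: y_def idx intro!: bexI[of _ "vl ! i"])
    fix u assume u: "u \<in> verts G"
    define i where "i = vertex_index G u"
    have i: "i < ?n" "vl ! i = u" using vertex_index[OF u] by (auto simp: i_def)
    have "\<kappa> * y u = \<bar>(A\<^sub>G *\<^sub>v x) $ i\<bar>"
      using i x \<kappa>_pos by (simp add: y_def i_def[symmetric] abs_mult)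
    also have "(A\<^sub>G *\<^sub>v x) $ i = (\<Sum>j<?n. A\<^sub>G $$ (i, j) * x $ j)"
      using i x(1) by (simp add: scalar_prod_def lessThan_atLeast0)
    also have "\<bar>\<dots>\<bar> \<le> (\<Sum>j<?n. \<bar>A\<^sub>G $$ (i, j) * x $ j\<bar>)"
      by (rule sum_abs)
    also have "\<dots> = (\<Sum>j<?n. A\<^sub>G $$ (i, j) * y (vl ! j))"
      using i by (intro sum.cong) (auto simp: abs_mult y_def idx adjacency_matrix_def)
    also have "\<dots> = (\<Sum>e\<in>out_arcs G u. y (head G e))"
      using sum_out_arcs[OF i(1), of y] i(2) by simp
    finally show "\<kappa> * y u \<le> (\<Sum>e\<in>out_arcs G u. y (head G e))" .
  qed
qed

lemma arcs_nonempty: "arcs G \<noteq> {}"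
proof
  assume "arcs G = {}"
  obtain y :: "'a \<Rightarrow> real" where y: "\<And>u. u \<in> verts G \<Longrightarrow> 0 \<le> y u" "\<exists>u\<in>verts G. y u \<noteq> 0"
    "\<And>u. u \<in> verts G \<Longrightarrow> \<kappa> * y u \<le> (\<Sum>e\<in>out_arcs G u. y (head G e))"
    using nonneg_subharmonic_vector by blast
  obtain u where u: "u \<in> verts G" "y u \<noteq> 0" using y(2) by blast
  have "\<kappa> * y u \<le> 0"
    using y(3)[OF u(1)] \<open>arcs G = {}\<close> by (simp add: out_arcs_def)
  moreover have "0 < \<kappa> * y u" using y(1)[OF u(1)] u(2) \<kappa>_pos by simp
  ultimately show False by simp
qed

text \<open>The spikes make the growth strictly faster than that of the walks: the criterion for spiked
  walks is met at some $x < \rho$.\<close>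

lemma entropy_gt_ln_perron:
  assumes "\<rho> < 1"
  shows "- ln \<rho> < topological_entropy (markov_dyck_shift G)"
proof -
  obtain y :: "'a \<Rightarrow> real" where y: "\<And>u. u \<in> verts G \<Longrightarrow> 0 \<le> y u" "\<exists>u\<in>verts G. y u \<noteq> 0"
    "\<And>u. u \<in> verts G \<Longrightarrow> \<kappa> * y u \<le> (\<Sum>e\<in>out_arcs G u. y (head G e))"
    using nonneg_subharmonic_vector by blast
  \<comment> \<open>Any $x < \rho$ with $x + x^3 \ge \rho$ will do; for this one, $x \ge \rho/2$ gives
    $x(1+x^2) \ge x(1+\rho^2/4) = \rho$.\<close>
  define x where "x = \<rho> / (1 + \<rho>\<^sup>2 / 4)"
  have "\<rho>\<^sup>2 < 1" using power_strict_mono[of \<rho> 1 2] \<rho>_pos assms by simp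
  have d: "0 < 1 + \<rho>\<^sup>2 / 4" by (simp add: add_pos_nonneg)
  have x0: "0 < x" using \<rho>_pos d by (simp add: x_def)
  have x\<rho>: "x < \<rho>" using \<rho>_pos d by (simp add: x_def field_simps)
  have "\<rho> / 2 \<le> x"
    unfolding x_def
  proof (rule divide_left_mono)
    show "0 < 2 * (1 + \<rho>\<^sup>2 / 4)" by (rule mult_pos_pos[OF _ d]) simp
  qed (use \<rho>_pos \<open>\<rho>\<^sup>2 < 1\<close> in auto)
  then have "(\<rho> / 2)\<^sup>2 \<le> x\<^sup>2" using \<rho>_pos by (intro power_mono) auto
  then have "1 + \<rho>\<^sup>2 / 4 \<le> 1 + x\<^sup>2" by (simp add: power_divide)
  then have "x * (1 + \<rho>\<^sup>2 / 4) \<le> x * (1 + x\<^sup>2)"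
    using x0 by (intro mult_left_mono) auto
  moreover have "x * (1 + \<rho>\<^sup>2 / 4) = \<rho>" using d by (simp add: x_def)
  ultimately have "\<rho> \<le> x + x ^ 3"
    by (simp add: algebra_simps power2_eq_square power3_eq_cube)
  then have "\<rho> * \<kappa> \<le> (x + x ^ 3) * \<kappa>" using \<kappa>_pos by (intro mult_right_mono) auto
  then have "1 \<le> (x + x ^ 3) * \<kappa>" using \<kappa>_pos by (simp add: \<rho>_def)
  from entropy_ge_by_spikes[OF x0 this y(1,2) y(3) arcs_nonempty]
  have "- ln x \<le> topological_entropy (markov_dyck_shift G)" by blast
  moreover have "ln x < ln \<rho>" using x0 x\<rho> by simp
  ultimately show ?thesis by simp
qed

text \<open>
  The Dyck insertions are weighed at $x = \rho e^{-t/M}$ with $e^t = 1 + u$. Jensen's inequality for the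
  weights $\rho^{|a|}$ and $\rho^{2|a|}$ bounds $F(x)$ and $F(x^2)$. The second application needs
  that the mean length for $\rho^{2|a|}$ is still at most $M$, which holds because these
  weights favour short loops more strongly.
\<close>

lemma entropy_ge_recurrent:
  assumes v: "v \<in> verts G" and nz: "p_minor G v \<rho> \<noteq> 0" and "\<rho> < 1"
  defines "M \<equiv> - (\<rho> * deriv (p_det G) \<rho>) / p_minor G v \<rho>"
  shows "0 < M" and "0 < F v (\<rho>\<^sup>2)"
    and "- ln \<rho> + ln (1 + F v (\<rho>\<^sup>2)) / M \<le> topological_entropy (markov_dyck_shift G)"
proof -
  let ?R = "first_returns v"
  define u where "u = F v (\<rho>\<^sup>2)"
  note conv = first_returns_at_\<rho>(1)[OF v]
  note rec = first_returns_recurrent[OF v nz, folded M_def]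
  have "\<rho>\<^sup>2 \<le> \<rho>" using \<rho>_pos \<open>\<rho> < 1\<close> by (simp add: power2_eq_square mult_left_le)
  then have conv2: "gf_conv ?R (\<rho>\<^sup>2)" by (intro gf_conv_mono[OF conv]) auto
  have "?R \<noteq> {}"
    using rec(1) by (auto simp: gen_fun_def)
  then show u0: "0 < F v (\<rho>\<^sup>2)"
    using conv2 \<rho>_pos by (intro gen_fun_pos_if_nonempty) auto
  have u1: "u < 1"
    using first_returns_at_\<rho>_square[OF v \<open>\<rho> < 1\<close>] \<open>\<rho> < 1\<close> by (simp add: u_def)
  have "F v \<rho> \<le> (\<Sum>\<^sub>\<infinity>a\<in>?R. \<rho> ^ length a * real (length a))"
    unfolding gen_fun_def
  proof (intro infsum_mono conv rec(2))
    fix a assume "a \<in> ?R"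
    then have "1 \<le> real (length a)" by (cases a) (auto simp: first_returns_def)
    then show "\<rho> ^ length a \<le> \<rho> ^ length a * real (length a)"
      using \<rho>_pos by (simp add: mult_le_cancel_left1)
  qed
  then show M0: "0 < M" using rec(1,3) by simp
  define t where "t = ln (1 + u)"
  have t0: "0 \<le> t" using u0 by (simp add: t_def u_def)
  have exp_t: "exp t = 1 + u" using u0 by (simp add: t_def u_def)
  define x where "x = \<rho> * exp (- (t / M))"
  have x: "0 < x" "x \<le> \<rho>" using \<rho>_pos t0 M0 by (auto simp: x_def)
  have conv_x: "gf_conv ?R x" using x by (intro gf_conv_mono[OF conv]) auto
  have x_pow: "x ^ n = \<rho> ^ n * exp (- (t / M * real n))" for n
    by (simp add: x_def power_mult_distrib exp_of_nat_mult[symmetric] mult_ac)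
  have x2_pow: "(x\<^sup>2) ^ n = (\<rho>\<^sup>2) ^ n * exp (- (2 * t / M * real n))" for n
    by (simp add: x_def power_mult_distrib exp_of_nat_mult[symmetric] mult_ac power2_eq_square exp_add[symmetric])
  have x2: "x\<^sup>2 \<le> \<rho>" using power_mono[OF x(2), of 2] x(1) \<open>\<rho>\<^sup>2 \<le> \<rho>\<close> by linarith
  have conv_x2: "gf_conv ?R (x\<^sup>2)" using x2 by (intro gf_conv_mono[OF conv]) auto
  have Fx: "exp (- t) \<le> F v x"
  proof -
    have "exp (- (t / M * M)) * F v \<rho> \<le> F v x"
      unfolding gen_fun_def x_pow
      using conv conv_x rec \<rho>_pos t0 M0 unfolding x_pow
      by (intro exp_moment_ge) (auto simp: gen_fun_def)
    then show ?thesis using rec(1) M0 by simp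
  qed
  have summ2: "(\<lambda>a. (\<rho>\<^sup>2) ^ length a * real (length a)) summable_on ?R"
  proof (rule summable_on_comparison_test[OF rec(2)])
    fix a
    have "(\<rho>\<^sup>2) ^ length a \<le> \<rho> ^ length a"
      using \<open>\<rho>\<^sup>2 \<le> \<rho>\<close> by (intro power_mono) auto
    then show "(\<rho>\<^sup>2) ^ length a * real (length a) \<le> \<rho> ^ length a * real (length a)"
      by (intro mult_right_mono) auto
  qed auto
  have mean2: "(\<Sum>\<^sub>\<infinity>a\<in>?R. (\<rho>\<^sup>2) ^ length a * real (length a)) \<le> M * (\<Sum>\<^sub>\<infinity>a\<in>?R. (\<rho>\<^sup>2) ^ length a)"
  proof -
    define c where "c = \<rho> powr M"
    have c0: "0 \<le> c" by (simp add: c_def)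
    \<comment> \<open>Chebyshev's trick: $n - M$ and $\rho^n - \rho^M$ have opposite signs, so
      $(n-M)\rho^{2n} \le \rho^M (n-M)\rho^n$, and the sum of the right-hand sides is at most $0$.\<close>
    have cheb: "(\<rho>\<^sup>2) ^ length a * real (length a) + - M * (\<rho>\<^sup>2) ^ length a
      \<le> c * (\<rho> ^ length a * real (length a)) + - (c * M) * \<rho> ^ length a" for a :: "'b list"
    proof -
      define n where "n = real (length a)"
      have pw: "\<rho> ^ length a = \<rho> powr n" using \<rho>_pos by (simp add: n_def powr_realpow)
      have "(n - M) * \<rho> powr n \<le> (n - M) * c"
      proof (cases "M \<le> n")
        case True
        then have "\<rho> powr n \<le> c"
          unfolding c_def using \<rho>_pos \<open>\<rho> < 1\<close> by (intro powr_mono') auto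
        with True show ?thesis by (intro mult_left_mono) auto
      next
        case False
        then have "c \<le> \<rho> powr n"
          unfolding c_def using \<rho>_pos \<open>\<rho> < 1\<close> by (intro powr_mono') auto
        with False show ?thesis by (intro mult_left_mono_neg) auto
      qed
      then have "\<rho> ^ length a * ((n - M) * \<rho> ^ length a) \<le> \<rho> ^ length a * ((n - M) * c)"
        unfolding pw by (rule mult_left_mono) simp
      then show ?thesis
        by (simp add: n_def[symmetric] algebra_simps power2_eq_square power_mult_distrib)
    qed
    note s1 = summ2 summable_on_cmult_right[OF conv2, of "- M"]
    note s2 = summable_on_cmult_right[OF rec(2), of c] summable_on_cmult_right[OF conv, of "- (c * M)"]
    have "(\<Sum>\<^sub>\<infinity>a\<in>?R. (\<rho>\<^sup>2) ^ length a * real (length a)) + - M * (\<Sum>\<^sub>\<infinity>a\<in>?R. (\<rho>\<^sup>2) ^ length a)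
      = (\<Sum>\<^sub>\<infinity>a\<in>?R. (\<rho>\<^sup>2) ^ length a * real (length a) + - M * (\<rho>\<^sup>2) ^ length a)"
      by (simp only: infsum_add[OF s1] infsum_cmult_right')
    also have "\<dots> \<le> (\<Sum>\<^sub>\<infinity>a\<in>?R. c * (\<rho> ^ length a * real (length a)) + - (c * M) * \<rho> ^ length a)"
      by (intro infsum_mono summable_on_add s1 s2 cheb)
    also have "\<dots> = c * (\<Sum>\<^sub>\<infinity>a\<in>?R. \<rho> ^ length a * real (length a)) + - (c * M) * F v \<rho>"
      by (simp only: infsum_add[OF s2] infsum_cmult_right' gen_fun_def)
    also have "\<dots> = c * ((\<Sum>\<^sub>\<infinity>a\<in>?R. \<rho> ^ length a * real (length a)) - M)"
      by (simp add: rec(1) algebra_simps)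
    also have "\<dots> \<le> 0" using rec(3) c0 by (simp add: mult_nonneg_nonpos)
    finally show ?thesis by simp
  qed
  have Fx2: "u / (exp t)\<^sup>2 \<le> F v (x\<^sup>2)"
  proof -
    have "exp (- (2 * t / M * M)) * F v (\<rho>\<^sup>2) \<le> F v (x\<^sup>2)"
      unfolding gen_fun_def x2_pow
      using conv2 conv_x2 summ2 mean2 t0 M0 unfolding x2_pow
      by (intro exp_moment_ge) auto
    moreover have "(exp t)\<^sup>2 = exp (2 * t)" by (simp add: exp_double)
    ultimately show ?thesis using M0
      by (simp add: u_def exp_minus field_simps)
  qed
  have "- ln x \<le> topological_entropy (markov_dyck_shift G)"
  proof (rule entropy_ge_by_dyck_insertions[OF arcs_nonempty x(1) conv_x])
    fix B assume B: "1 \<le> B" "B = 1 + F v (x\<^sup>2) * B\<^sup>2"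
    have "exp t \<le> B"
      using u0 u1 t0 exp_t by (intro quadratic_root_ge[OF _ _ _ _ Fx2 B]) (auto simp: u_def)
    then have "exp t * exp (- t) \<le> B * F v x"
      using Fx B(1) by (intro mult_mono) auto
    then show "1 \<le> B * F v x" by (simp add: exp_minus)
  qed
  moreover have "- ln x = - ln \<rho> + t / M"
    using \<rho>_pos by (simp add: x_def ln_mult)
  ultimately show "- ln \<rho> + ln (1 + F v (\<rho>\<^sup>2)) / M \<le> topological_entropy (markov_dyck_shift G)"
    by (simp add: t_def u_def)
qed

lemma entropy_gt_term:
  assumes v: "v \<in> verts G" and \<rho>: "\<rho> < 1/4"
  defines "s \<equiv> sqrt (q_ratio G v (\<rho>\<^sup>2) - 3/4)"
  shows "- ln \<rho> + p_minor G v \<rho> * (q_ratio G v (\<rho>\<^sup>2) - 3/4 - 1/2 * s) / (\<rho> * deriv (p_det G) \<rho> * (\<rho> + s))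
    < topological_entropy (markov_dyck_shift G)"
proof (cases "p_minor G v \<rho> = 0")
  case True
  then show ?thesis using entropy_gt_ln_perron \<rho> by simp
next
  case False
  define M where "M = - (\<rho> * deriv (p_det G) \<rho>) / p_minor G v \<rho>"
  define u where "u = F v (\<rho>\<^sup>2)"
  have \<rho>1: "\<rho> < 1" using \<rho> by simp
  note ge = entropy_ge_recurrent[OF v False \<rho>1, folded M_def u_def]
  have u\<rho>: "u \<le> \<rho>" using first_returns_at_\<rho>_square[OF v \<rho>1] by (simp add: u_def)
  have q: "q_ratio G v (\<rho>\<^sup>2) - 3/4 = 1/4 - u"
    using q_ratio_at_\<rho>_square[OF v \<rho>1] by (simp add: u_def)
  have s: "0 < s" "s\<^sup>2 = 1/4 - u" using u\<rho> \<rho> by (auto simp: s_def q)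
  have M_eq: "\<rho> * deriv (p_det G) \<rho> = - M * p_minor G v \<rho>" using False by (simp add: M_def)
  have "p_minor G v \<rho> * (q_ratio G v (\<rho>\<^sup>2) - 3/4 - 1/2 * s) / (\<rho> * deriv (p_det G) \<rho> * (\<rho> + s))
      = s * (1 / 2 - s) / (\<rho> + s) / M"
  proof -
    have num: "p_minor G v \<rho> * (s\<^sup>2 - 1/2 * s) = (- p_minor G v \<rho>) * (s * (1 / 2 - s))"
      by (simp add: algebra_simps power2_eq_square)
    have den: "- M * p_minor G v \<rho> * (\<rho> + s) = (- p_minor G v \<rho>) * ((\<rho> + s) * M)"
      by (simp add: algebra_simps)
    show ?thesis
      unfolding M_eq q s(2)[symmetric] num den using False
      by (subst mult_divide_mult_cancel_left) auto
  qed
  also have "\<dots> < ln (1 + u) / M"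
    using entropy_gain_bound[OF ge(2) u\<rho> s] ge(1) by (intro divide_strict_right_mono)
  finally show ?thesis using ge(3) by simp
qed

end

theorem corollary3p7:
  fixes G :: "('v, 'e) pre_digraph" and \<kappa> \<rho> :: real
  assumes "fin_digraph G"
    and "perron_eigenvalue (adjacency_matrix G) \<kappa>"
    and "\<kappa> > 0"
    and "\<rho> = 1 / \<kappa>"
    and "\<rho> < 1/4"
  shows "topological_entropy (markov_dyck_shift G) >
    - ln \<rho> +
    Max {p_minor G v \<rho> * (q_ratio G v (\<rho>\<^sup>2) - 3/4 - 1/2 * sqrt (q_ratio G v (\<rho>\<^sup>2) - 3/4)) /
         (\<rho> * deriv (p_det G) \<rho> * (\<rho> + sqrt (q_ratio G v (\<rho>\<^sup>2) - 3/4)))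
         | v. v \<in> verts G \<and> q_ratio G v (\<rho>\<^sup>2) > 3/4}"
    (is "_ > _ + Max ?T")
proof -
  interpret perron_digraph G \<kappa> \<rho>
    using assms by (intro perron_digraph.intro perron_digraph_axioms.intro)
  have q: "q_ratio G v (\<rho>\<^sup>2) > 3/4" if "v \<in> verts G" for v
    using that assms(5) q_ratio_at_\<rho>_square[of v] first_returns_at_\<rho>_square[of v] by simp
  have "finite ?T"
    by (rule finite_subset[OF _ finite_imageI[OF finite_verts]]) auto
  moreover have "?T \<noteq> {}"
  proof -
    obtain e where "e \<in> arcs G" using arcs_nonempty by blast
    then have "tail G e \<in> verts G" by simp
    with q show ?thesis by blast
  qed
  moreover have "x < topological_entropy (markov_dyck_shift G) + ln \<rho>" if "x \<in> ?T" for x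
    using that entropy_gt_term[OF _ assms(5)] by force
  ultimately have "Max ?T < topological_entropy (markov_dyck_shift G) + ln \<rho>"
    by (subst Max_less_iff) auto
  then show ?thesis by simp
qed
end
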